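(* Let $\mu$ be a positive Borel measure on $[0,1)$ such that the measure $\nu$ on $[0,1)$ defined by $d\nu(t)=\log\frac{2}{1-t}\,d\mu(t)$ is a Carleson measure. Then the operator $\mathcal H_\mu$ is bounded from $\mathcal B$ into $BMOA$.
   Context: $\mathbb D=\{z\in\mathbb C:|z|<1\}$. The Bloch space $\mathcal B$ is the set of analytic functions $f$ in $\mathbb D$ with $\|f\|_{\mathcal B}=|f(0)|+\sup_{z\in\mathbb D}(1-|z|^2)|f'(z)|<\infty$. For $a\in\mathbb D$ let $\varphi_a(z)=\frac{a-z}{1-\overline a z}$; $BMOA$ is the set of analytic functions $f$ in $\mathbb D$ with $\|f\|_{BMOA}=|f(0)|+\sup_{a\in\mathbb D}\|f\circ\varphi_a-f(a)\|_{H^2}<\infty$, where $H^2$ is the Hardy space. For a finite positive Borel measure $\mu$ on $[0,1)$, $\mu_n=\int_{[0,1)}t^n\,d\mu(t)$, and for $f(z)=\sum_{k\ge0}a_kz^k$ analytic in $\mathbb D$, $$\mathcal H_\mu(f)(z)=\sum_{n=0}^\infty\Big(\sum_{k=0}^\infty\mu_{n+k}a_k\Big)z^n,$$ whenever the right-hand side makes sense and defines an analytic function in $\mathbb D$; boundedness of $\mathcal H_\mu$ on a space includes that it is well defined for every $f$ in the space. A positive Borel measure $\nu$ on $[0,1)$ is a Carleson measure if there is $C>0$ with $\nu([t,1))\le C(1-t)$ for all $0\le t<1$. *)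

theory Defs
  imports "HOL-Complex_Analysis.Complex_Analysis"
begin

abbreviation unit_disc :: "complex set" where
  "unit_disc \<equiv> ball 0 1"

text \<open>
  Norms take values in the extended nonnegative reals, so that the condition
  ``norm finite'' is literally \<open>norm < \<infinity>\<close>. Analytic functions on the disc are
  represented by total functions; only their values on \<open>unit_disc\<close> matter.
\<close>

definition bloch_norm :: "(complex \<Rightarrow> complex) \<Rightarrow> ennreal" where
  "bloch_norm f =
     ennreal (cmod (f 0)) + (SUP z\<in>unit_disc. ennreal ((1 - (cmod z)\<^sup>2) * cmod (deriv f z)))"

definition bloch :: "(complex \<Rightarrow> complex) set" where
  "bloch = {f. f holomorphic_on unit_disc \<and> bloch_norm f < \<infinity>}"

text \<open>The integral means are only applied to functions continuous on the disc.\<close>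

definition hardy2_norm :: "(complex \<Rightarrow> complex) \<Rightarrow> ennreal" where
  "hardy2_norm g =
     (SUP r\<in>{0..<1::real}.
        ennreal (sqrt (1 / (2 * pi) *
          integral {0..2 * pi} (\<lambda>\<theta>. (cmod (g (of_real r * cis \<theta>)))\<^sup>2))))"

definition disc_aut :: "complex \<Rightarrow> complex \<Rightarrow> complex" where
  "disc_aut a z = (a - z) / (1 - cnj a * z)"

definition bmoa_norm :: "(complex \<Rightarrow> complex) \<Rightarrow> ennreal" where
  "bmoa_norm f =
     ennreal (cmod (f 0)) + (SUP a\<in>unit_disc. hardy2_norm (\<lambda>z. f (disc_aut a z) - f a))"

definition bmoa :: "(complex \<Rightarrow> complex) set" where
  "bmoa = {f. f holomorphic_on unit_disc \<and> bmoa_norm f < \<infinity>}"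

text \<open>Positive Borel measures on the interval \<open>[0,1)\<close>; the underlying space is \<open>[0,1)\<close> itself.\<close>

definition borel_measure_01 :: "real measure \<Rightarrow> bool" where
  "borel_measure_01 \<mu> \<longleftrightarrow> sets \<mu> = sets (restrict_space borel {0..<1})"

definition carleson_measure :: "real measure \<Rightarrow> bool" where
  "carleson_measure \<nu> \<longleftrightarrow>
     borel_measure_01 \<nu> \<and>
     (\<exists>C>0. \<forall>t\<in>{0..<1}. emeasure \<nu> {t..<1} \<le> ennreal (C * (1 - t)))"

definition moment :: "real measure \<Rightarrow> nat \<Rightarrow> real" where
  "moment \<mu> n = (LINT t|\<mu>. t ^ n)"

abbreviation taylor_coeff :: "(complex \<Rightarrow> complex) \<Rightarrow> nat \<Rightarrow> complex" where
  "taylor_coeff f k \<equiv> fps_nth (fps_expansion f 0) k"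

definition hankel_coeff :: "real measure \<Rightarrow> (complex \<Rightarrow> complex) \<Rightarrow> nat \<Rightarrow> complex" where
  "hankel_coeff \<mu> f n = (\<Sum>k. of_real (moment \<mu> (n + k)) * taylor_coeff f k)"

definition hankel_op :: "real measure \<Rightarrow> (complex \<Rightarrow> complex) \<Rightarrow> complex \<Rightarrow> complex" where
  "hankel_op \<mu> f z = (\<Sum>n. hankel_coeff \<mu> f n * z ^ n)"

text \<open>
  The integral and the infinite sums above are total operators in HOL. The following predicate
  says that all of them really exist and that the resulting function is analytic in the disc.
\<close>

definition hankel_well_defined :: "real measure \<Rightarrow> (complex \<Rightarrow> complex) \<Rightarrow> bool" where
  "hankel_well_defined \<mu> f \<longleftrightarrow>
     (\<forall>n. integrable \<mu> (\<lambda>t. t ^ n)) \<and>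
     (\<forall>n. summable (\<lambda>k. of_real (moment \<mu> (n + k)) * taylor_coeff f k)) \<and>
     (\<forall>z\<in>unit_disc. summable (\<lambda>n. hankel_coeff \<mu> f n * z ^ n)) \<and>
     hankel_op \<mu> f holomorphic_on unit_disc"

definition hankel_bounded_bloch_bmoa :: "real measure \<Rightarrow> bool" where
  "hankel_bounded_bloch_bmoa \<mu> \<longleftrightarrow>
     (\<forall>f\<in>bloch. hankel_well_defined \<mu> f \<and> hankel_op \<mu> f \<in> bmoa) \<and>
     (\<exists>C\<ge>0. \<forall>f\<in>bloch. bmoa_norm (hankel_op \<mu> f) \<le> ennreal C * bloch_norm f)"

end

theory Submission
  imports Defs
begin

text \<open>
  Write \<open>d\<nu> = log (2 / (1 - t)) d\<mu>\<close>. A Bloch function grows at most like \<open>log (2 / (1 - t))\<close>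
  along the radius \<open>[0,1)\<close>, so that \<open>|f| d\<mu>\<close> is dominated by a multiple of \<open>\<nu>\<close>. This is
  what the logarithm is for; what remains is about Cauchy integrals against a Carleson measure.

  Summing the power series under the integral sign gives
  \<open>F(z) = H f(z) = \<integral> f(t) / (1 - t z) d\<mu>(t)\<close> (\<open>hankel_coeff_eq\<close>, \<open>hankel_op_sums\<close>). The interchange needs
  the series \<open>\<Sum> \<mu>\<^sub>k |a\<^sub>k|\<close> to converge. The moments are \<open>O(1 / k)\<close> by the Carleson condition, and
  \<open>\<Sum> |a\<^sub>k| / k\<close> converges because the mean square of \<open>f'\<close> over the circle of radius \<open>1 - 1 / (2 N)\<close>
  bounds the \<open>l\<^sup>2\<close> norm of the coefficients with index between \<open>N\<close> and \<open>2 N\<close>, uniformly in \<open>N\<close>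
  (\<open>coeff_summable\<close>).

  For the BMOA norm no duality is used. With \<open>\<phi>\<close> the disc automorphism that exchanges \<open>0\<close> and \<open>a\<close>,
  the function \<open>F \<circ> \<phi> - F(a)\<close> is the integral against \<open>f d\<mu>\<close> of the kernels
  \<open>1 / (1 - t \<phi>(z)) - 1 / (1 - t a)\<close>. Such a kernel is again a multiple of
  \<open>z\<close> times a Cauchy kernel, so its Hardy norm can be computed; it is at most
  \<open>w(t) = sqrt (1 - |a|\<^sup>2) / ((1 - |a| t) sqrt (1 - t))\<close> (\<open>disc_kernel_diff_hardy2\<close>). By Minkowski's
  inequality the norm of \<open>F \<circ> \<phi> - F(a)\<close> is at most a multiple of \<open>\<integral> w d\<nu>\<close>. As \<open>w\<close> is increasing, a
  Carleson measure integrates it no worse than a multiple of Lebesgue measure does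
  (\<open>integral_increasing_le\<close>), and \<open>\<integral> w(t) dt\<close> over \<open>[0,1)\<close> is bounded by \<open>3 \<pi>\<close> whatever \<open>a\<close> is
  (\<open>nn_integral_disc_kernel_le\<close>).
\<close>

section \<open>Increasing functions against a Carleson measure\<close>

lemma nn_integral_layer_cake:
  fixes g :: "'a \<Rightarrow> real"
  assumes "sigma_finite_measure M" and [measurable]: "g \<in> borel_measurable M"
  shows "(\<integral>\<^sup>+x. ennreal (g x) \<partial>M)
       = (\<integral>\<^sup>+s. emeasure M {x\<in>space M. 0 \<le> s \<and> s < g x} \<partial>lborel)"
proof -
  interpret M: sigma_finite_measure M by fact
  interpret pair_sigma_finite M lborel ..
  have "(\<integral>\<^sup>+x. ennreal (g x) \<partial>M)
      = (\<integral>\<^sup>+x. \<integral>\<^sup>+s. indicator {p. 0 \<le> snd p \<and> snd p < g (fst p)} (x, s) \<partial>lborel \<partial>M)"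
  proof (rule nn_integral_cong)
    fix x
    have "(\<integral>\<^sup>+s. indicator {p. 0 \<le> snd p \<and> snd p < g (fst p)} (x, s) \<partial>lborel)
        = (\<integral>\<^sup>+s. indicator {0..<g x} s \<partial>lborel)"
      by (intro nn_integral_cong) (auto split: split_indicator)
    also have "\<dots> = ennreal (g x)"
      by (cases "0 \<le> g x") (auto simp: ennreal_neg)
    finally show "ennreal (g x)
      = (\<integral>\<^sup>+s. indicator {p. 0 \<le> snd p \<and> snd p < g (fst p)} (x, s) \<partial>lborel)" ..
  qed
  also have "\<dots> = (\<integral>\<^sup>+s. \<integral>\<^sup>+x. indicator {p. 0 \<le> snd p \<and> snd p < g (fst p)} (x, s) \<partial>M \<partial>lborel)"
    by (rule Fubini'[symmetric]) measurable
  also have "\<dots> = (\<integral>\<^sup>+s. emeasure M {x\<in>space M. 0 \<le> s \<and> s < g x} \<partial>lborel)"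
  proof (rule nn_integral_cong)
    fix s :: real
    have "(\<integral>\<^sup>+x. indicator {p. 0 \<le> snd p \<and> snd p < g (fst p)} (x, s) \<partial>M)
        = (\<integral>\<^sup>+x. indicator {x\<in>space M. 0 \<le> s \<and> s < g x} x \<partial>M)"
      by (intro nn_integral_cong) (auto split: split_indicator)
    also have "\<dots> = emeasure M {x\<in>space M. 0 \<le> s \<and> s < g x}"
      by (subst nn_integral_indicator) auto
    finally show "(\<integral>\<^sup>+x. indicator {p. 0 \<le> snd p \<and> snd p < g (fst p)} (x, s) \<partial>M)
      = emeasure M {x\<in>space M. 0 \<le> s \<and> s < g x}" .
  qed
  finally show ?thesis .
qed

locale carleson_01 =
  fixes \<nu> :: "real measure" and C :: real
  assumes sets_nu: "sets \<nu> = sets (restrict_space borel {0..<1})"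
    and C_nonneg: "0 \<le> C"
    and tail_le: "\<And>t. t \<in> {0..<1} \<Longrightarrow> emeasure \<nu> {t..<1} \<le> ennreal (C * (1 - t))"
begin

lemma space_nu [simp]: "space \<nu> = {0..<1}"
  using sets_eq_imp_space_eq[OF sets_nu] by (simp add: space_restrict_space)

lemma total_mass_le: "emeasure \<nu> {0..<1} \<le> ennreal C"
  using tail_le[of 0] by simp

lemma finite_nu: "finite_measure \<nu>"
  using total_mass_le by (intro finite_measureI) (auto simp: top_unique)

lemma measurable_nuI: "g \<in> borel_measurable (restrict_space borel {0..<1}) \<Longrightarrow> g \<in> borel_measurable \<nu>"
  using measurable_cong_sets[OF sets_nu refl] by blast

text \<open>
  The superlevel sets of an increasing function are intervals with right end point \<open>1\<close>. On these
  \<open>\<nu>\<close> is at most \<open>C\<close> times Lebesgue measure, and by the layer cake formula that is all the integral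
  sees.
\<close>

lemma integral_increasing_le:
  assumes mono: "mono_on {0..<1} g"
  shows "(\<integral>\<^sup>+t. ennreal (g t) \<partial>\<nu>)
       \<le> ennreal C * (\<integral>\<^sup>+t. ennreal (g t) * indicator {0..<1} t \<partial>lborel)"
proof -
  interpret finite_measure \<nu> by (rule finite_nu)
  define L where "L = restrict_space lborel {0..<1::real}"
  have space_L: "space L = {0..<1}" and sets_L: "sets L = sets (restrict_space borel {0..<1})"
    by (simp_all add: L_def space_restrict_space sets_restrict_space)
  have emL: "emeasure L X = emeasure lborel X" if "X \<subseteq> {0..<1}" for X
    using that by (simp add: L_def emeasure_restrict_space)
  interpret L: finite_measure L
    by (rule finite_measureI) (simp add: space_L emL)
  have g0: "g \<in> borel_measurable (restrict_space borel {0..<1})"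
    by (rule borel_measurable_mono_on_fnc[OF mono])
  have g1 [measurable]: "g \<in> borel_measurable \<nu>" by (rule measurable_nuI[OF g0])
  have g2 [measurable]: "g \<in> borel_measurable L"
    using g0 measurable_cong_sets[OF sets_L refl] by blast
  have "(\<integral>\<^sup>+t. ennreal (g t) \<partial>\<nu>)
      = (\<integral>\<^sup>+s. emeasure \<nu> {t\<in>{0..<1}. 0 \<le> s \<and> s < g t} \<partial>lborel)"
    by (subst nn_integral_layer_cake) (auto intro: sigma_finite_measure_axioms)
  also have "\<dots> \<le> (\<integral>\<^sup>+s. ennreal C * emeasure L {t\<in>{0..<1}. 0 \<le> s \<and> s < g t} \<partial>lborel)"
  proof (rule nn_integral_mono)
    fix s :: real
    define U where "U = {t\<in>{0..<1}. 0 \<le> s \<and> s < g t}"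
    have "{t\<in>space \<nu>. 0 \<le> s \<and> s < g t} \<in> sets \<nu>" "{t\<in>space L. 0 \<le> s \<and> s < g t} \<in> sets L"
      by measurable
    hence [measurable]: "U \<in> sets \<nu>" "U \<in> sets L" by (auto simp: U_def space_L)
    show "emeasure \<nu> U \<le> ennreal C * emeasure L U"
    proof (cases "U = {}")
      case False
      define t0 where "t0 = Inf U"
      have bdd: "bdd_below U" by (rule bdd_belowI[of _ 0]) (auto simp: U_def)
      have t0: "t0 \<in> {0..<1}"
      proof -
        obtain u where u: "u \<in> U" using False by auto
        have "t0 \<le> u" using u bdd by (simp add: t0_def cInf_lower)
        moreover have "0 \<le> t0" unfolding t0_def by (rule cInf_greatest[OF False]) (auto simp: U_def)
        ultimately show ?thesis using u by (auto simp: U_def)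
      qed
      have sub: "U \<subseteq> {t0..<1}"
        using bdd by (auto simp: U_def t0_def intro!: cInf_lower)
      \<comment> \<open>The end point \<open>t0\<close> may be missing from \<open>U\<close>, but points are Lebesgue null.\<close>
      have sup: "{t0<..<1} \<subseteq> U"
      proof
        fix t assume t: "t \<in> {t0<..<1}"
        then obtain u where u: "u \<in> U" "u < t"
          using False bdd cInf_less_iff[of U t] by (auto simp: t0_def)
        have "g u \<le> g t" using u t t0 by (intro mono_onD[OF mono]) (auto simp: U_def)
        thus "t \<in> U" using u t t0 by (auto simp: U_def)
      qed
      have "emeasure \<nu> U \<le> emeasure \<nu> {t0..<1}"
        using t0 by (intro emeasure_mono sub) (auto simp: sets_nu sets_restrict_space_iff)
      also have "\<dots> \<le> ennreal (C * (1 - t0))" by (rule tail_le[OF t0])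
      also have "\<dots> = ennreal C * emeasure L {t0<..<1}"
        using t0 C_nonneg by (subst emL) (auto simp: ennreal_mult)
      also have "\<dots> \<le> ennreal C * emeasure L U"
        by (intro mult_left_mono emeasure_mono sup) auto
      finally show ?thesis .
    qed simp
  qed
  also have "\<dots> = ennreal C * (\<integral>\<^sup>+s. emeasure L {t\<in>{0..<1}. 0 \<le> s \<and> s < g t} \<partial>lborel)"
    by (intro nn_integral_cmult) (simp flip: space_L)
  also have "(\<integral>\<^sup>+s. emeasure L {t\<in>{0..<1}. 0 \<le> s \<and> s < g t} \<partial>lborel) = (\<integral>\<^sup>+t. ennreal (g t) \<partial>L)"
    by (subst nn_integral_layer_cake) (auto intro: L.sigma_finite_measure_axioms simp: space_L)
  also have "\<dots> = (\<integral>\<^sup>+t. ennreal (g t) * indicator {0..<1} t \<partial>lborel)"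
    unfolding L_def by (subst nn_integral_restrict_space) auto
  finally show ?thesis .
qed

end

text \<open>
  With \<open>x = 1 - t\<close> and \<open>\<delta> = 1 - r\<close> the integrand is comparable to \<open>sqrt \<delta> / ((\<delta> + x) sqrt x)\<close>. Times
  \<open>dx\<close>, this is invariant under joint scaling of \<open>x\<close> and \<open>\<delta>\<close>; a primitive is
  \<open>2 arctan (sqrt (x / \<delta>))\<close>, whence a bound that does not depend on \<open>r\<close>.
\<close>

lemma nn_integral_disc_kernel_le:
  assumes r: "0 \<le> r" "r < 1"
  shows "(\<integral>\<^sup>+t. ennreal (sqrt (1 - r\<^sup>2) / ((1 - r * t) * sqrt (1 - t))) * indicator {0..<1} t \<partial>lborel)
     \<le> ennreal (3 * pi)"
proof -
  define \<delta> where "\<delta> = 1 - r"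
  have d: "\<delta> > 0" "\<delta> \<le> 1" using r by (auto simp: \<delta>_def)
  define k where "k = (\<lambda>t. sqrt \<delta> / ((\<delta> + (1 - t)) * sqrt (1 - t)))"
  define F where "F = (\<lambda>t. - 2 * arctan (sqrt ((1 - t) / \<delta>)))"
  have deriv: "DERIV F t :> k t" if "0 < t" "t < 1" for t
  proof -
    have p: "sqrt (1 - t) > 0" "sqrt \<delta> > 0" using that d by auto
    have "DERIV F t :> - 2 * (inverse (1 + (sqrt ((1 - t) / \<delta>))\<^sup>2) *
        (inverse (sqrt ((1 - t) / \<delta>)) / 2 * (- 1 / \<delta>)))"
      unfolding F_def using that d
      by (auto intro!: derivative_eq_intros simp: field_simps)
    also have "(sqrt ((1 - t) / \<delta>))\<^sup>2 = (1 - t) / \<delta>"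
      using that d by simp
    also have "- 2 * (inverse (1 + (1 - t) / \<delta>) *
        (inverse (sqrt ((1 - t) / \<delta>)) / 2 * (- 1 / \<delta>))) = k t"
    proof -
      have "inverse (1 + (1 - t) / \<delta>) = \<delta> / (\<delta> + (1 - t))" using d that by (simp add: field_simps)
      moreover have "inverse (sqrt ((1 - t) / \<delta>)) = sqrt \<delta> / sqrt (1 - t)"
        by (simp add: real_sqrt_divide)
      ultimately show ?thesis unfolding k_def using d by simp
    qed
    finally show ?thesis .
  qed
  have cont: "isCont k t" if "0 < t" "t < 1" for t
    unfolding k_def using that d by (intro continuous_intros) auto
  have nonneg: "0 \<le> k t" if "t \<le> 1" for t
    unfolding k_def using that d by auto
  have contF: "continuous_on UNIV F"
    unfolding F_def by (intro continuous_intros) (use d in auto)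
  have lim0: "((F \<circ> real_of_ereal) \<longlongrightarrow> F 0) (at_right 0)"
    unfolding comp_def zero_ereal_def
    by (subst ereal_tendsto_simps1[unfolded comp_def]) (use contF in \<open>auto simp: continuous_on_def intro: tendsto_within_subset\<close>)
  have lim1: "((F \<circ> real_of_ereal) \<longlongrightarrow> F 1) (at_left 1)"
    unfolding comp_def one_ereal_def
    by (subst ereal_tendsto_simps1[unfolded comp_def]) (use contF in \<open>auto simp: continuous_on_def intro: tendsto_within_subset\<close>)
  note FTC = interval_integral_FTC_nonneg[of 0 1 F k, OF _ _ _ _ lim0 lim1]
  have int: "set_integrable lborel {0<..<1} k" and val: "(LBINT t=0..1. k t) = F 1 - F 0"
    using FTC deriv cont nonneg by (auto simp: zero_ereal_def one_ereal_def)
  have val': "(\<integral>t. indicator {0<..<1} t *\<^sub>R k t \<partial>lborel) \<le> pi"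
  proof -
    have "(LBINT t=0..1. k t) = (\<integral>t. indicator {0<..<1} t *\<^sub>R k t \<partial>lborel)"
      by (simp add: interval_lebesgue_integral_def set_lebesgue_integral_def zero_ereal_def one_ereal_def)
    moreover have "F 1 - F 0 \<le> pi" using arctan_ubound[of "sqrt (1/\<delta>)"] by (simp add: F_def)
    ultimately show ?thesis using val by simp
  qed
  have pt: "sqrt (1 - r\<^sup>2) / ((1 - r * t) * sqrt (1 - t)) \<le> 3 * k t" if t: "0 \<le> t" "t < 1" for t
  proof -
    have "sqrt (1 - r\<^sup>2) \<le> 3/2 * sqrt \<delta>"
    proof (rule real_le_lsqrt)
      have "1 - r\<^sup>2 = \<delta> * (2 - \<delta>)" by (simp add: \<delta>_def power2_eq_square algebra_simps)
      also have "\<dots> \<le> \<delta> * (9/4)" using d by (intro mult_left_mono) auto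
      finally show "1 - r\<^sup>2 \<le> (3/2 * sqrt \<delta>)\<^sup>2" using d by (simp add: power_mult_distrib power2_eq_square)
    qed (use d in auto)
    moreover have "(\<delta> + (1 - t)) / 2 \<le> 1 - r * t"
    proof -
      have "0 \<le> \<delta> * t + (1 - \<delta>) * (1 - t)" using d t by auto
      thus ?thesis by (simp add: \<delta>_def algebra_simps add_divide_distrib diff_divide_distrib)
    qed
    ultimately have "sqrt (1 - r\<^sup>2) / (1 - r * t) \<le> (3/2 * sqrt \<delta>) / ((\<delta> + (1 - t)) / 2)"
      using d t by (intro frac_le) auto
    hence "sqrt (1 - r\<^sup>2) / (1 - r * t) / sqrt (1 - t) \<le> (3/2 * sqrt \<delta>) / ((\<delta> + (1 - t)) / 2) / sqrt (1 - t)"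
      using t by (intro divide_right_mono) auto
    thus ?thesis by (simp add: k_def)
  qed
  have "(\<integral>\<^sup>+t. ennreal (sqrt (1 - r\<^sup>2) / ((1 - r * t) * sqrt (1 - t))) * indicator {0..<1} t \<partial>lborel)
     \<le> (\<integral>\<^sup>+t. ennreal (3 * (indicator {0<..<1} t *\<^sub>R k t)) \<partial>lborel)"
    using AE_lborel_singleton[of "0::real"]
    by (intro nn_integral_mono_AE) (auto split: split_indicator intro!: ennreal_leI pt elim!: eventually_mono)
  also have "\<dots> = ennreal (\<integral>t. 3 * (indicator {0<..<1} t *\<^sub>R k t) \<partial>lborel)"
    using int by (intro nn_integral_eq_integral) (auto simp: set_integrable_def nonneg split: split_indicator)
  also have "\<dots> = ennreal (3 * (\<integral>t. (indicator {0<..<1} t *\<^sub>R k t) \<partial>lborel))"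
    by simp
  also have "\<dots> \<le> ennreal (3 * pi)" using val' by (intro ennreal_leI) auto
  finally show ?thesis .
qed

section \<open>Parseval on circles\<close>

lemma has_integral_cis_int:
  "((\<lambda>\<theta>. cis (of_int k * \<theta>)) has_integral (if k = 0 then of_real (2 * pi) else 0)) {0..2 * pi}"
proof (cases "k = 0")
  case True
  thus ?thesis using has_integral_const_real[of "1::complex" 0 "2*pi"] by (simp add: scaleR_conv_of_real)
next
  case False
  have ii: "- (\<i> * (a * (\<i> * b))) = a * b" for a b
    by (simp add: complex_eq_iff algebra_simps)
  have "((\<lambda>\<theta>. cis (of_int k * \<theta>)) has_integral
      cis (of_int k * (2 * pi)) / (\<i> * of_int k) - cis (of_int k * 0) / (\<i> * of_int k)) {0..2 * pi}"
    using False by (intro fundamental_theorem_of_calculus)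
      (auto intro!: derivative_eq_intros simp: has_vector_derivative_def fun_eq_iff scaleR_conv_of_real ii)
  moreover have "cis (of_int k * (2 * pi)) = 1"
    using cis_multiple_2pi[of "of_int k"] by (simp add: mult_ac)
  ultimately show ?thesis using False by simp
qed

lemma has_integral_norm_trig_poly_square:
  fixes c :: "nat \<Rightarrow> complex"
  shows "((\<lambda>\<theta>. (cmod (\<Sum>n<N. c n * cis (real n * \<theta>)))\<^sup>2) has_integral
            2 * pi * (\<Sum>n<N. (cmod (c n))\<^sup>2)) {0..2 * pi}"
proof -
  have sq: "complex_of_real ((cmod (\<Sum>n<N. c n * cis (real n * \<theta>)))\<^sup>2)
      = (\<Sum>n<N. \<Sum>m<N. c n * cnj (c m) * cis (of_int (int n - int m) * \<theta>))" for \<theta>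
  proof -
    have cis: "cis (of_int (int n - int m) * \<theta>) = cis (real n * \<theta>) * cnj (cis (real m * \<theta>))" for n m
      by (simp add: cis_cnj cis_mult left_diff_distrib)
    show ?thesis
      unfolding cis by (subst complex_norm_square) (simp add: sum_product mult_ac)
  qed
  have diag: "(\<Sum>n<N. \<Sum>m<N. c n * cnj (c m) * (if int n - int m = 0 then of_real (2 * pi) else 0))
      = complex_of_real (2 * pi * (\<Sum>n<N. (cmod (c n))\<^sup>2))"
  proof -
    have "(\<Sum>m<N. c n * cnj (c m) * (if int n - int m = 0 then of_real (2 * pi) else 0))
        = of_real (2 * pi * (cmod (c n))\<^sup>2)" if "n < N" for n
    proof -
      have "(\<Sum>m<N. c n * cnj (c m) * (if int n - int m = 0 then of_real (2 * pi) else 0))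
          = (\<Sum>m<N. if n = m then c n * cnj (c m) * of_real (2 * pi) else 0)"
        by (intro sum.cong) auto
      also have "\<dots> = of_real (2 * pi * (cmod (c n))\<^sup>2)"
        using that by (simp add: complex_norm_square[symmetric] del: of_real_power) 
      finally show ?thesis .
    qed
    thus ?thesis by (simp add: sum_distrib_left)
  qed
  have "((\<lambda>\<theta>. \<Sum>n<N. \<Sum>m<N. c n * cnj (c m) * cis (of_int (int n - int m) * \<theta>)) has_integral
         (\<Sum>n<N. \<Sum>m<N. c n * cnj (c m) * (if int n - int m = 0 then of_real (2 * pi) else 0))) {0..2 * pi}"
    by (intro has_integral_sum finite_lessThan has_integral_mult_right has_integral_cis_int)
  hence "((\<lambda>\<theta>. complex_of_real ((cmod (\<Sum>n<N. c n * cis (real n * \<theta>)))\<^sup>2)) has_integral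
      complex_of_real (2 * pi * (\<Sum>n<N. (cmod (c n))\<^sup>2))) {0..2 * pi}"
    by (simp only: sq diag)
  from has_integral_linear[OF this bounded_linear_Re] show ?thesis
    by (simp add: o_def del: of_real_power of_real_mult)
qed

text \<open>
  The partial sums converge uniformly, hence so do their squared moduli, and for those the
  identity is the orthogonality of the characters \<open>cis (n \<theta>)\<close>.
\<close>

theorem parseval_circle:
  fixes c :: "nat \<Rightarrow> complex"
  assumes c: "summable (\<lambda>n. cmod (c n))"
  shows "(\<lambda>n. 2 * pi * (cmod (c n))\<^sup>2) sums
           integral {0..2 * pi} (\<lambda>\<theta>. (cmod (\<Sum>n. c n * cis (real n * \<theta>)))\<^sup>2)"
proof -
  define s where "s = (\<lambda>N \<theta>. \<Sum>n<N. c n * cis (real n * \<theta>))"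
  define S where "S = (\<lambda>\<theta>. \<Sum>n. c n * cis (real n * \<theta>))"
  have ul: "uniform_limit {0..2*pi} s S sequentially"
    unfolding s_def S_def by (rule Weierstrass_m_test[OF _ c]) (simp add: norm_mult)
  have bS: "bounded (S ` {0..2*pi})"
  proof (rule boundedI)
    fix y assume "y \<in> S ` {0..2*pi}"
    then obtain t where y: "y = S t" by auto
    have "cmod (S t) \<le> (\<Sum>n. cmod (c n * cis (real n * t)))"
      unfolding S_def by (rule summable_norm) (simp add: norm_mult c)
    thus "norm y \<le> (\<Sum>n. cmod (c n))" by (simp add: y norm_mult)
  qed
  have uln: "uniform_limit {0..2*pi} (\<lambda>N \<theta>. cmod (s N \<theta>)) (\<lambda>\<theta>. cmod (S \<theta>)) sequentially"
    using ul by (rule uniform_limit_norm)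
  have "uniform_limit {0..2*pi} (\<lambda>N \<theta>. cmod (s N \<theta>) * cmod (s N \<theta>)) (\<lambda>\<theta>. cmod (S \<theta>) * cmod (S \<theta>)) sequentially"
    using bS by (intro uniform_lim_mult uln) (auto simp: bounded_iff)
  hence ul2: "uniform_limit {0..2*pi} (\<lambda>N \<theta>. (cmod (s N \<theta>))\<^sup>2) (\<lambda>\<theta>. (cmod (S \<theta>))\<^sup>2) sequentially"
    by (simp add: power2_eq_square)
  obtain I J where I: "\<And>N. ((\<lambda>\<theta>. (cmod (s N \<theta>))\<^sup>2) has_integral I N) {0..2*pi}"
    and J: "((\<lambda>\<theta>. (cmod (S \<theta>))\<^sup>2) has_integral J) {0..2*pi}" and lim: "I \<longlonglongrightarrow> J"
  proof (rule uniform_limit_integral[OF ul2])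
    show "continuous_on {0..2*pi} (\<lambda>\<theta>. (cmod (s N \<theta>))\<^sup>2)" for N
      unfolding s_def by (intro continuous_intros)
  qed auto
  have I_eq: "I N = (\<Sum>n<N. 2 * pi * (cmod (c n))\<^sup>2)" for N
    using has_integral_unique[OF I[unfolded s_def] has_integral_norm_trig_poly_square]
    by (simp add: sum_distrib_left)
  have "I = (\<lambda>N. \<Sum>n<N. 2 * pi * (cmod (c n))\<^sup>2)" by (rule ext) (rule I_eq)
  moreover have "integral {0..2*pi} (\<lambda>\<theta>. (cmod (S \<theta>))\<^sup>2) = J"
    using J by (rule integral_unique)
  ultimately show ?thesis using lim by (simp add: sums_def S_def)
qed

lemma integral_cauchy_kernel_square:
  assumes v: "cmod v < 1"
  shows "integral {0..2 * pi} (\<lambda>\<theta>. 1 / (cmod (1 - v * cis \<theta>))\<^sup>2) = 2 * pi / (1 - (cmod v)\<^sup>2)"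
proof -
  have "(\<Sum>n. v ^ n * cis (real n * \<theta>)) = 1 / (1 - v * cis \<theta>)" for \<theta>
    using suminf_geometric[of "v * cis \<theta>"] v by (simp add: power_mult_distrib norm_mult Complex.DeMoivre)
  hence "(\<lambda>n. 2 * pi * (cmod (v ^ n))\<^sup>2) sums integral {0..2 * pi} (\<lambda>\<theta>. 1 / (cmod (1 - v * cis \<theta>))\<^sup>2)"
    using parseval_circle[of "\<lambda>n. v ^ n"] v
    by (simp add: norm_power norm_divide power_divide)
  moreover have "(\<lambda>n. 2 * pi * ((cmod v)\<^sup>2) ^ n) sums (2 * pi * (1 / (1 - (cmod v)\<^sup>2)))"
    using v by (intro sums_mult geometric_sums) (simp add: abs_square_less_1)
  moreover have "(cmod (v ^ n))\<^sup>2 = ((cmod v)\<^sup>2) ^ n" for n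
    by (simp add: norm_power mult.commute flip: power_mult)
  ultimately have "(\<lambda>n. 2 * pi * ((cmod v)\<^sup>2) ^ n) sums integral {0..2 * pi} (\<lambda>\<theta>. 1 / (cmod (1 - v * cis \<theta>))\<^sup>2)"
    "(\<lambda>n. 2 * pi * ((cmod v)\<^sup>2) ^ n) sums (2 * pi * (1 / (1 - (cmod v)\<^sup>2)))"
    by simp_all
  from sums_unique2[OF this] show ?thesis by simp
qed

lemma taylor_sums:
  assumes "g holomorphic_on unit_disc" "cmod z < 1"
  shows "(\<lambda>k. taylor_coeff g k * z ^ k) sums g z"
  using holomorphic_power_series[of g 0 1 z] assms by (simp add: fps_expansion_def)

lemma taylor_abs_summable:
  fixes t :: real
  assumes g: "g holomorphic_on unit_disc" and t: "0 \<le> t" "t < 1"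
  shows "summable (\<lambda>k. cmod (taylor_coeff g k) * t ^ k)"
proof -
  have "summable (\<lambda>k. norm (taylor_coeff g k * (of_real t) ^ k))"
  proof (rule powser_insidea)
    show "summable (\<lambda>k. taylor_coeff g k * (of_real ((1 + t) / 2)) ^ k)"
      using taylor_sums[OF g, of "of_real ((1 + t) / 2)"] t
      by (auto simp: sums_iff simp del: of_real_add of_real_divide)
    show "norm (of_real t :: complex) < norm (of_real ((1 + t) / 2) :: complex)"
      using t by (simp del: of_real_add of_real_divide)
  qed
  thus ?thesis using t by (simp add: norm_mult norm_power)
qed

lemma taylor_coeff_bessel:
  assumes g: "g holomorphic_on unit_disc" and r: "0 \<le> r" "r < 1"
    and M: "\<And>z. cmod z = r \<Longrightarrow> cmod (g z) \<le> M"
  shows "(\<Sum>n<N. (cmod (taylor_coeff g n))\<^sup>2 * r ^ (2 * n)) \<le> M\<^sup>2"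
proof -
  define b where "b = (\<lambda>n. taylor_coeff g n)"
  have c: "summable (\<lambda>n. cmod (b n * of_real r ^ n))"
    using taylor_abs_summable[OF g r] r by (simp add: b_def norm_mult norm_power)
  have eq: "(\<Sum>n. b n * of_real r ^ n * cis (real n * \<theta>)) = g (of_real r * cis \<theta>)" for \<theta>
    using taylor_sums[OF g, of "of_real r * cis \<theta>"] r
    by (simp add: b_def sums_iff norm_mult power_mult_distrib Complex.DeMoivre mult_ac)
  have P: "(\<lambda>n. 2 * pi * (cmod (b n * of_real r ^ n))\<^sup>2) sums
      integral {0..2 * pi} (\<lambda>\<theta>. (cmod (g (of_real r * cis \<theta>)))\<^sup>2)"
    using parseval_circle[OF c] by (simp add: eq)
  have "(\<Sum>n<N. 2 * pi * (cmod (b n * of_real r ^ n))\<^sup>2)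
     \<le> integral {0..2 * pi} (\<lambda>\<theta>. (cmod (g (of_real r * cis \<theta>)))\<^sup>2)"
    using sum_le_suminf[OF sums_summable[OF P], of "{..<N}"] sums_unique[OF P] by simp
  also have "\<dots> \<le> integral {0..2 * pi} (\<lambda>\<theta>. M\<^sup>2)"
  proof (rule integral_le)
    have "continuous_on {0..2*pi} (\<lambda>\<theta>. (cmod (g (of_real r * cis \<theta>)))\<^sup>2)"
      using r by (intro continuous_intros continuous_on_compose2[OF holomorphic_on_imp_continuous_on[OF g]])
        (auto simp: norm_mult)
    thus "(\<lambda>\<theta>. (cmod (g (of_real r * cis \<theta>)))\<^sup>2) integrable_on {0..2*pi}"
      by (rule integrable_continuous_real)
  qed (use r in \<open>auto intro!: power_mono M simp: norm_mult\<close>)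
  also have "\<dots> = 2 * pi * M\<^sup>2" by simp
  finally have "2 * pi * (\<Sum>n<N. (cmod (b n * of_real r ^ n))\<^sup>2) \<le> 2 * pi * M\<^sup>2"
    by (simp add: sum_distrib_left)
  hence "(\<Sum>n<N. (cmod (b n * of_real r ^ n))\<^sup>2) \<le> M\<^sup>2"
    by (rule mult_left_le_imp_le) simp
  moreover have "(cmod (b n * of_real r ^ n))\<^sup>2 = (cmod (taylor_coeff g n))\<^sup>2 * r ^ (2 * n)" for n
    using r by (simp add: b_def norm_mult norm_power power_mult_distrib power_even_eq)
  ultimately show ?thesis by (simp only: )
qed

section \<open>Bloch functions\<close>

text \<open>
  Unlike the condensation test, this applies to sequences that are not monotone.
\<close>

lemma summable_of_dyadic_blocks:
  fixes u :: "nat \<Rightarrow> real"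
  assumes u: "\<And>n. 0 \<le> u n" and q: "0 \<le> q" "q < 1" and K: "0 \<le> K"
    and block: "\<And>j. (\<Sum>n=2^j..<2^Suc j. u n) \<le> K * q ^ j"
  shows "summable u"
proof (rule summableI_nonneg_bounded[OF u])
  fix N
  have "(\<Sum>n<2^J. u n) \<le> u 0 + (\<Sum>j<J. K * q ^ j)" for J
  proof (induction J)
    case (Suc J)
    have "(\<Sum>n<2^Suc J. u n) = (\<Sum>n<2^J. u n) + (\<Sum>n=2^J..<2^Suc J. u n)"
      unfolding lessThan_atLeast0 by (rule sum.atLeastLessThan_concat[symmetric]) auto
    also have "\<dots> \<le> u 0 + (\<Sum>j<J. K * q ^ j) + K * q ^ J"
      using Suc.IH block[of J] by linarith
    finally show ?case by simp
  qed simp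
  from this[of N] have "(\<Sum>n<2^N. u n) \<le> u 0 + (\<Sum>j<N. K * q ^ j)" .
  moreover have "(\<Sum>n<N. u n) \<le> (\<Sum>n<2^N. u n)"
    using less_exp[of N] by (intro sum_mono2) (auto simp: u)
  moreover have "(\<Sum>j<N. K * q ^ j) \<le> (\<Sum>j. K * q ^ j)"
    using q K by (intro sum_le_suminf summable_mult summable_geometric) auto
  ultimately show "(\<Sum>n<N. u n) \<le> u 0 + (\<Sum>j. K * q ^ j)" by linarith
qed

lemma taylor_coeff_deriv:
  "taylor_coeff (deriv f) n = of_nat (Suc n) * taylor_coeff f (Suc n)"
  by (simp add: fps_expansion_def funpow_Suc_right del: funpow.simps of_nat_Suc)

lemma half_le_ln_2: "1/2 \<le> ln (2::real)"
  using ln_add_one_self_le_self2[of "-1/2"] ln_inverse[of "2::real"] by (simp add: inverse_eq_divide)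

text \<open>
  In the application \<open>\<beta>\<close> is the Bloch norm of \<open>f\<close> as a real number; it bounds both of its summands.
\<close>

locale bloch_function =
  fixes f :: "complex \<Rightarrow> complex" and \<beta> :: real
  assumes f: "f holomorphic_on unit_disc"
    and f0: "cmod (f 0) \<le> \<beta>"
    and deriv_le: "\<And>z. z \<in> unit_disc \<Longrightarrow> (1 - (cmod z)\<^sup>2) * cmod (deriv f z) \<le> \<beta>"
begin

lemma beta_nonneg: "0 \<le> \<beta>"
  using f0 norm_ge_zero order_trans by blast

lemma continuous_f: "continuous_on {0..<1} (\<lambda>t. f (complex_of_real t))"
  by (intro continuous_on_compose2[OF holomorphic_on_imp_continuous_on[OF f]] continuous_intros) auto

text \<open>
  The \<open>l\<^sup>2\<close> estimate comes from Bessel's inequality for \<open>f'\<close> on the circle of radius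
  \<open>1 - 1 / (2 N)\<close>: there \<open>|f'| \<le> 2 N \<beta>\<close>, while the powers of the radius with exponent up to \<open>4 N\<close>
  are at least \<open>1/16\<close>. The Cauchy-Schwarz inequality turns it into an \<open>l\<^sup>1\<close> estimate at the price of
  \<open>sqrt N\<close>, which the weight \<open>1 / n\<close> more than pays for.
\<close>

lemma coeff_block:
  assumes N: "1 \<le> N"
  shows "(\<Sum>n=N..<2*N. cmod (taylor_coeff f (Suc n)) / real (Suc n)) \<le> 8 * \<beta> / sqrt (real N)"
proof -
  define a where "a = (\<lambda>n. cmod (taylor_coeff f (Suc n)))"
  have a0: "a n \<ge> 0" for n by (simp add: a_def)
  define r where "r = 1 - 1 / (2 * real N)"
  have r: "0 \<le> r" "r < 1" using N by (auto simp: r_def field_simps)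
  have df: "deriv f holomorphic_on unit_disc" by (intro holomorphic_deriv f) auto
  have "cmod (deriv f z) \<le> 2 * real N * \<beta>" if "cmod z = r" for z
  proof -
    have "(1 - r) * cmod (deriv f z) \<le> (1 - r\<^sup>2) * cmod (deriv f z)"
      using r by (intro mult_right_mono) (auto simp: power2_eq_square mult_left_le)
    also have "\<dots> \<le> \<beta>" using deriv_le[of z] that r by simp
    finally show ?thesis using N by (simp add: r_def field_simps)
  qed
  from taylor_coeff_bessel[OF df r this, where N = "2*N"]
  have B: "(\<Sum>n<2*N. (real (Suc n) * a n)\<^sup>2 * r ^ (2 * n)) \<le> (2 * real N * \<beta>)\<^sup>2"
    by (simp add: taylor_coeff_deriv norm_mult a_def del: of_nat_Suc)
  have r16: "1/16 \<le> r ^ (2 * n)" if "n < 2 * N" for n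
  proof -
    have "1 + real N * (- 1 / (2 * real N)) \<le> (1 + (- 1 / (2 * real N))) ^ N"
      using N by (intro Bernoulli_inequality) (auto simp: field_simps)
    hence "1/2 \<le> r ^ N" using N by (simp add: r_def)
    hence "(1/2)^4 \<le> (r ^ N)^4" by (intro power_mono) auto
    moreover have "(r ^ N)^4 = r ^ (4 * N)" by (metis power_mult mult.commute)
    ultimately have "1/16 \<le> r ^ (4 * N)" by (simp add: power_divide)
    also have "\<dots> \<le> r ^ (2 * n)" using r that by (intro power_decreasing) auto
    finally show ?thesis .
  qed
  have "(\<Sum>n=N..<2*N. (a n)\<^sup>2) * ((real N)\<^sup>2 / 16) = (\<Sum>n=N..<2*N. (real N * a n)\<^sup>2 * (1/16))"
    by (simp add: sum_distrib_left sum_distrib_right power_mult_distrib mult_ac)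
  also have "\<dots> \<le> (\<Sum>n=N..<2*N. (real (Suc n) * a n)\<^sup>2 * r ^ (2 * n))"
    using r16 by (intro sum_mono mult_mono power_mono mult_right_mono) (auto simp: a0)
  also have "\<dots> \<le> (\<Sum>n<2*N. (real (Suc n) * a n)\<^sup>2 * r ^ (2 * n))"
    using r by (intro sum_mono2) auto
  also have "\<dots> \<le> (2 * real N * \<beta>)\<^sup>2" by (rule B)
  also have "\<dots> = (8 * \<beta>)\<^sup>2 * ((real N)\<^sup>2 / 16)" by (simp add: power_mult_distrib)
  finally have sq: "(\<Sum>n=N..<2*N. (a n)\<^sup>2) \<le> (8 * \<beta>)\<^sup>2"
    using N by simp
  have "(\<Sum>n=N..<2*N. a n)\<^sup>2 \<le> (\<Sum>n=N..<2*N. (a n)\<^sup>2) * real N"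
    using Cauchy_Schwarz_ineq_sum[of a "\<lambda>_. 1" "{N..<2*N}"] by simp
  also have "\<dots> \<le> (8 * \<beta>)\<^sup>2 * real N" using sq by (intro mult_right_mono) auto
  also have "\<dots> = (8 * \<beta> * sqrt (real N))\<^sup>2" by (simp add: power_mult_distrib)
  finally have l1: "(\<Sum>n=N..<2*N. a n) \<le> 8 * \<beta> * sqrt (real N)"
    by (rule power2_le_imp_le) (use beta_nonneg in auto)
  have "(\<Sum>n=N..<2*N. a n / real (Suc n)) \<le> (\<Sum>n=N..<2*N. a n / real N)"
    using N by (intro sum_mono divide_left_mono) (auto simp: a0)
  also have "\<dots> \<le> 8 * \<beta> * sqrt (real N) / real N"
    using l1 by (simp add: divide_right_mono flip: sum_divide_distrib)
  also have "\<dots> = 8 * \<beta> / sqrt (real N)"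
    using N by (simp add: field_simps)
  finally show ?thesis by (simp add: a_def)
qed

lemma coeff_summable:
  "summable (\<lambda>k. cmod (taylor_coeff f k) / (real k + 1))"
proof -
  have "summable (\<lambda>n. cmod (taylor_coeff f (Suc n)) / real (Suc n))"
  proof (rule summable_of_dyadic_blocks)
    show "(\<Sum>n=2^j..<2^Suc j. cmod (taylor_coeff f (Suc n)) / real (Suc n)) \<le> 8 * \<beta> * (1 / sqrt 2) ^ j" for j
      using coeff_block[of "2^j"] by (simp add: real_sqrt_power power_divide del: of_nat_Suc)
  qed (use beta_nonneg in auto)
  hence "summable (\<lambda>n. cmod (taylor_coeff f (Suc n)) / (real (Suc n) + 1))"
    by (rule summable_comparison_test'[where N = 0]) (auto intro!: divide_left_mono)
  thus ?thesis by (subst (asm) summable_Suc_iff)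
qed

text \<open>
  Integrate \<open>|f'(x)| \<le> \<beta> / (1 - x)\<close> from \<open>0\<close> to \<open>t\<close>. The constant \<open>|f(0)|\<close> is absorbed because the
  logarithm is at least \<open>ln 2\<close>; this is why the weight has a \<open>2\<close> in it.
\<close>

lemma growth:
  assumes t: "0 \<le> t" "t < 1"
  shows "cmod (f (of_real t)) \<le> 2 * \<beta> * ln (2 / (1 - t))"
proof -
  have "cmod (f (of_real t) - f (of_real 0)) \<le> - \<beta> * ln (1 - t) - (- \<beta> * ln (1 - 0))"
  proof (cases "t = 0")
    case False
    hence t0: "0 < t" using t by simp
    show ?thesis
    proof (rule differentiable_bound_general[OF t0, where f' = "\<lambda>x. deriv f (of_real x)" and \<phi>' = "\<lambda>x. \<beta> / (1 - x)"])
      show "continuous_on {0..t} (\<lambda>x. f (of_real x))"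
        using t by (intro continuous_on_compose2[OF holomorphic_on_imp_continuous_on[OF f]] continuous_intros) auto
      show "continuous_on {0..t} (\<lambda>t. - \<beta> * ln (1 - t))"
        using t by (intro continuous_intros) auto
    next
      fix x assume x: "0 < x" "x < t"
      show "((\<lambda>x. f (complex_of_real x)) has_vector_derivative deriv f (complex_of_real x)) (at x)"
        using x t by (intro has_vector_derivative_real_field holomorphic_derivI[OF f]) auto
      show "((\<lambda>t. - \<beta> * ln (1 - t)) has_vector_derivative \<beta> / (1 - x)) (at x)"
        using x t by (auto intro!: derivative_eq_intros simp flip: has_real_derivative_iff_has_vector_derivative)
      have "(1 - x) * cmod (deriv f (of_real x)) \<le> (1 - x\<^sup>2) * cmod (deriv f (of_real x))"
        using x t by (intro mult_right_mono) (auto simp: power2_eq_square mult_left_le)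
      also have "\<dots> \<le> \<beta>" using deriv_le[of "of_real x"] x t by simp
      finally show "cmod (deriv f (of_real x)) \<le> \<beta> / (1 - x)" using x t by (simp add: field_simps)
    qed
  qed simp
  hence "cmod (f (of_real t)) \<le> cmod (f 0) - \<beta> * ln (1 - t)"
    using norm_triangle_ineq2[of "f (of_real t)" "f 0"] by simp
  also have "\<dots> \<le> \<beta> * (1 - ln (1 - t))" using f0 by (simp add: algebra_simps)
  also have "\<dots> \<le> \<beta> * (2 * ln (2 / (1 - t)))"
  proof (intro mult_left_mono beta_nonneg)
    have "ln (1 - t) \<le> 0" "ln (2 / (1 - t)) = ln 2 - ln (1 - t)" using t by (simp_all add: ln_div)
    moreover note half_le_ln_2
    ultimately show "1 - ln (1 - t) \<le> 2 * ln (2 / (1 - t))" by linarith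
  qed
  finally show ?thesis by simp
qed

end

section \<open>Minkowski's inequality for mean squares\<close>

text \<open>
  The inequality between arithmetic and geometric mean gives
  \<open>|f| \<le> s w / 2 + f\<^sup>2 / (2 s w)\<close> pointwise for every \<open>s > 0\<close>. Integrating this and choosing \<open>s\<close>
  to balance the two terms gives the Cauchy-Schwarz inequality for \<open>sqrt w\<close> and \<open>f / sqrt w\<close>.
\<close>

lemma nn_integral_weighted_cauchy_schwarz:
  fixes f w :: "'a \<Rightarrow> real"
  assumes [measurable]: "f \<in> borel_measurable M" "w \<in> borel_measurable M"
    and w: "\<And>x. x \<in> space M \<Longrightarrow> 0 < w x"
    and A: "(\<integral>\<^sup>+x. ennreal (w x) \<partial>M) \<le> ennreal A" "0 < A"
  shows "(\<integral>\<^sup>+x. ennreal \<bar>f x\<bar> \<partial>M)\<^sup>2 \<le> ennreal A * (\<integral>\<^sup>+x. ennreal ((f x)\<^sup>2 / w x) \<partial>M)"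
proof -
  define X where "X = (\<integral>\<^sup>+x. ennreal \<bar>f x\<bar> \<partial>M)"
  define B where "B = (\<integral>\<^sup>+x. ennreal ((f x)\<^sup>2 / w x) \<partial>M)"
  have X_le: "X \<le> ennreal (s / 2 * A) + ennreal (1 / (2 * s)) * B" if s: "0 < s" for s
  proof -
    have "X \<le> (\<integral>\<^sup>+x. ennreal (s / 2) * ennreal (w x) + ennreal (1 / (2 * s)) * ennreal ((f x)\<^sup>2 / w x) \<partial>M)"
      unfolding X_def
    proof (rule nn_integral_mono)
      fix x assume x: "x \<in> space M"
      have "0 \<le> (s * w x - \<bar>f x\<bar>)\<^sup>2" by simp
      hence "2 * s * w x * \<bar>f x\<bar> \<le> (s * w x)\<^sup>2 + (f x)\<^sup>2"
        by (simp add: power2_diff)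
      hence "\<bar>f x\<bar> \<le> s / 2 * w x + 1 / (2 * s) * ((f x)\<^sup>2 / w x)"
        using s w[OF x] by (simp add: field_simps power2_eq_square)
      thus "ennreal \<bar>f x\<bar> \<le> ennreal (s / 2) * ennreal (w x) + ennreal (1 / (2 * s)) * ennreal ((f x)\<^sup>2 / w x)"
        using s w[OF x] by (simp flip: ennreal_mult ennreal_plus)
    qed
    also have "\<dots> = ennreal (s / 2) * (\<integral>\<^sup>+x. ennreal (w x) \<partial>M) + ennreal (1 / (2 * s)) * B"
      unfolding B_def by (subst nn_integral_add) (auto simp: nn_integral_cmult)
    also have "\<dots> \<le> ennreal (s / 2) * ennreal A + ennreal (1 / (2 * s)) * B"
      using A by (intro add_mono mult_left_mono) auto
    also have "ennreal (s / 2) * ennreal A = ennreal (s / 2 * A)"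
      using s A by (simp flip: ennreal_mult)
    finally show ?thesis .
  qed
  have "X\<^sup>2 \<le> ennreal A * B"
  proof (cases "B = \<infinity> \<or> X = 0")
    case True
    thus ?thesis using A by (auto simp: ennreal_mult_top)
  next
    case False
    then obtain b where b: "B = ennreal b" "0 \<le> b" by (cases B) auto
    have X_le': "X \<le> ennreal (s / 2 * A + 1 / (2 * s) * b)" if "0 < s" for s
    proof -
      have "ennreal (s / 2 * A + 1 / (2 * s) * b) = ennreal (s / 2 * A) + ennreal (1 / (2 * s) * b)"
        using that A b by (intro ennreal_plus) auto
      also have "ennreal (1 / (2 * s) * b) = ennreal (1 / (2 * s)) * B"
        unfolding b(1) using that b(2) by (intro ennreal_mult) auto
      finally show ?thesis using X_le[OF that] by (simp only:)
    qed
    have "X \<noteq> \<infinity>" using X_le'[of 1] by (auto simp: top_unique)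
    then obtain x where x: "X = ennreal x" "0 \<le> x" by (cases X) auto
    hence x0: "0 < x" using False by (cases "x = 0") auto
    \<comment> \<open>The parameter is chosen such that the first term is half of the left-hand side.\<close>
    have "ennreal x \<le> ennreal (x / A / 2 * A + 1 / (2 * (x / A)) * b)"
      using X_le'[of "x / A"] x0 A x by simp
    hence "x \<le> x / 2 + A * b / (2 * x)" using x0 A b by (subst (asm) ennreal_le_iff) auto
    hence "x\<^sup>2 \<le> A * b" using x0 by (simp add: field_simps power2_eq_square)
    thus ?thesis using x b A by (simp add: ennreal_power flip: ennreal_mult)
  qed
  thus ?thesis by (simp add: X_def B_def)
qed

text \<open>
  Minkowski's inequality \<open>\<parallel>\<integral> h d M\<parallel> \<le> \<integral> \<parallel>h\<parallel> d M\<close> for \<open>L\<^sup>2\<close> norms, with a majorant \<open>w\<close> in place of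
  \<open>\<parallel>h\<parallel>\<close>. The majorant serves as weight in the Cauchy-Schwarz inequality; after exchanging the
  integrals, \<open>\<parallel>h\<parallel>\<^sup>2 / w \<le> w\<close> is left. Keeping \<open>w\<close> strictly positive makes division by it harmless where
  \<open>h\<close> vanishes.
\<close>

lemma minkowski_square:
  fixes h :: "'b \<Rightarrow> 'a \<Rightarrow> real" and w :: "'a \<Rightarrow> real"
  assumes "sigma_finite_measure M" "sigma_finite_measure N"
    and h [measurable]: "(\<lambda>(y, x). h y x) \<in> borel_measurable (N \<Otimes>\<^sub>M M)"
    and w_meas [measurable]: "w \<in> borel_measurable M"
    and w: "\<And>x. x \<in> space M \<Longrightarrow> 0 < w x"
    and A: "(\<integral>\<^sup>+x. ennreal (w x) \<partial>M) \<le> ennreal A" "0 < A"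
    and L: "0 \<le> L"
      "\<And>x. x \<in> space M \<Longrightarrow> (\<integral>\<^sup>+y. ennreal ((h y x)\<^sup>2) \<partial>N) \<le> ennreal (L * (w x)\<^sup>2)"
  shows "(\<integral>\<^sup>+y. (\<integral>\<^sup>+x. ennreal \<bar>h y x\<bar> \<partial>M)\<^sup>2 \<partial>N) \<le> ennreal (L * A\<^sup>2)"
proof -
  interpret M: sigma_finite_measure M by fact
  interpret N: sigma_finite_measure N by fact
  interpret pair_sigma_finite N M ..
  have "(\<integral>\<^sup>+y. (\<integral>\<^sup>+x. ennreal \<bar>h y x\<bar> \<partial>M)\<^sup>2 \<partial>N)
     \<le> (\<integral>\<^sup>+y. ennreal A * (\<integral>\<^sup>+x. ennreal ((h y x)\<^sup>2 / w x) \<partial>M) \<partial>N)"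
    by (intro nn_integral_mono nn_integral_weighted_cauchy_schwarz A w) measurable
  also have "\<dots> = ennreal A * (\<integral>\<^sup>+y. \<integral>\<^sup>+x. ennreal ((h y x)\<^sup>2 / w x) \<partial>M \<partial>N)"
    by (rule nn_integral_cmult) measurable
  also have "(\<integral>\<^sup>+y. \<integral>\<^sup>+x. ennreal ((h y x)\<^sup>2 / w x) \<partial>M \<partial>N)
      = (\<integral>\<^sup>+x. \<integral>\<^sup>+y. ennreal ((h y x)\<^sup>2 / w x) \<partial>N \<partial>M)"
    by (rule Fubini'[symmetric]) measurable
  also have "\<dots> \<le> (\<integral>\<^sup>+x. ennreal L * ennreal (w x) \<partial>M)"
  proof (rule nn_integral_mono)
    fix x assume x: "x \<in> space M"
    have [measurable]: "(\<lambda>y. h y x) \<in> borel_measurable N" using x by measurable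
    have "(\<integral>\<^sup>+y. ennreal ((h y x)\<^sup>2 / w x) \<partial>N) = (\<integral>\<^sup>+y. ennreal (1 / w x) * ennreal ((h y x)\<^sup>2) \<partial>N)"
      using w[OF x] by (intro nn_integral_cong) (simp flip: ennreal_mult)
    also have "\<dots> = ennreal (1 / w x) * (\<integral>\<^sup>+y. ennreal ((h y x)\<^sup>2) \<partial>N)"
      by (rule nn_integral_cmult) measurable
    also have "\<dots> \<le> ennreal (1 / w x) * ennreal (L * (w x)\<^sup>2)"
      by (intro mult_left_mono L x) auto
    also have "\<dots> = ennreal L * ennreal (w x)"
      using w[OF x] L by (simp add: power2_eq_square flip: ennreal_mult)
    finally show "(\<integral>\<^sup>+y. ennreal ((h y x)\<^sup>2 / w x) \<partial>N) \<le> ennreal L * ennreal (w x)" .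
  qed
  also have "\<dots> = ennreal L * (\<integral>\<^sup>+x. ennreal (w x) \<partial>M)" by (rule nn_integral_cmult) measurable
  also have "ennreal A * \<dots> \<le> ennreal A * (ennreal L * ennreal A)"
    by (intro mult_left_mono A) auto
  also have "\<dots> = ennreal (L * A\<^sup>2)"
    using L A by (simp add: power2_eq_square mult_ac flip: ennreal_mult)
  finally show ?thesis by (simp add: mult_left_mono)
qed

lemma nn_integral_continuous_Icc:
  fixes k :: "real \<Rightarrow> real"
  assumes "continuous_on {a..b} k" and k: "\<And>x. x \<in> {a..b} \<Longrightarrow> 0 \<le> k x"
  shows "(\<integral>\<^sup>+x. ennreal (k x) \<partial>restrict_space lborel {a..b}) = ennreal (integral {a..b} k)"
proof -
  have "(k has_integral integral {a..b} k) {a..b}"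
    using assms by (intro integrable_integral integrable_continuous_real)
  from nn_integral_has_integral_lebesgue'[OF k this] show ?thesis
    by (subst nn_integral_restrict_space) auto
qed

section \<open>Cauchy kernels under disc automorphisms\<close>

text \<open>
  If \<open>F(z) = \<integral> 1 / (1 - t z) d\<sigma>(t)\<close>, then the integral of this kernel against \<open>\<sigma>\<close> is
  \<open>F(disc_aut a z) - F(a)\<close>.
\<close>

definition disc_kernel_diff :: "complex \<Rightarrow> real \<Rightarrow> complex \<Rightarrow> complex" where
  "disc_kernel_diff a t z = 1 / (1 - of_real t * disc_aut a z) - 1 / (1 - of_real t * a)"

lemma disc_kernel_nonzero:
  assumes "cmod z < 1" "cmod w \<le> 1" shows "1 - w * z \<noteq> 0"
proof
  assume "1 - w * z = 0"
  hence "1 = cmod w * cmod z" by (metis eq_iff_diff_eq_0 norm_mult norm_one)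
  also have "\<dots> \<le> 1 * cmod z" using assms by (intro mult_right_mono) auto
  finally show False using assms by simp
qed

lemma moebius_identity:
  "(cmod (1 - cnj a * z))\<^sup>2 - (cmod (a - z))\<^sup>2 = (1 - (cmod a)\<^sup>2) * (1 - (cmod z)\<^sup>2)"
  unfolding cmod_power2 by (simp add: power2_eq_square algebra_simps)

lemma disc_aut_in_disc:
  assumes "cmod a < 1" "cmod z < 1" shows "cmod (disc_aut a z) < 1"
proof -
  have "0 < (1 - (cmod a)\<^sup>2) * (1 - (cmod z)\<^sup>2)" using assms by (simp add: abs_square_less_1)
  hence "(cmod (a - z))\<^sup>2 < (cmod (1 - cnj a * z))\<^sup>2" using moebius_identity[of a z] by linarith
  hence "cmod (a - z) < cmod (1 - cnj a * z)" by (rule power2_less_imp_less) simp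
  thus ?thesis by (simp add: disc_aut_def norm_divide divide_less_eq_1)
qed

text \<open>
  Composing a Cauchy kernel with a disc automorphism gives, up to a constant, a Cauchy kernel with
  another pole, multiplied by the linear factor \<open>1 - cnj a * z\<close>. Subtracting the value at \<open>0\<close>
  turns this factor into a multiple of \<open>z\<close>.
\<close>

lemma disc_kernel_diff_eq:
  fixes t :: real
  assumes a: "cmod a < 1" and z: "cmod z < 1" and t: "0 \<le> t" "t < 1"
  shows "disc_kernel_diff a t z = - of_real (t * (1 - (cmod a)\<^sup>2)) * z /
     ((1 - of_real t * a)\<^sup>2 * (1 - (cnj a - of_real t) / (1 - of_real t * a) * z))"
proof -
  define p q s where "p = 1 - cnj a * z" and "q = 1 - of_real t * a"
    and "s = q - (cnj a - of_real t) * z"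
  have p: "p \<noteq> 0" unfolding p_def using a z by (intro disc_kernel_nonzero) auto
  have q: "q \<noteq> 0" unfolding q_def using a t by (intro disc_kernel_nonzero) auto
  have ps: "p * (1 - of_real t * disc_aut a z) = s"
  proof -
    have pd: "p * disc_aut a z = a - z" using p by (simp add: disc_aut_def flip: p_def)
    have "p * (1 - of_real t * disc_aut a z) = p - of_real t * (p * disc_aut a z)"
      by (simp add: algebra_simps)
    also have "\<dots> = s" unfolding pd by (simp add: p_def q_def s_def algebra_simps)
    finally show ?thesis .
  qed
  have s: "s \<noteq> 0"
    using disc_kernel_nonzero[OF disc_aut_in_disc[OF a z], of "of_real t"] t p unfolding ps[symmetric] by simp
  have "1 / (1 - of_real t * disc_aut a z) = p / s"
    unfolding ps[symmetric] using p by simp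
  hence "disc_kernel_diff a t z = p / s - 1 / q" by (simp add: disc_kernel_diff_def q_def)
  also have "\<dots> = (p * q - s) / (q * s)" using q s by (simp add: field_simps)
  also have "p * q - s = - of_real t * (1 - a * cnj a) * z"
    by (simp add: p_def q_def s_def algebra_simps)
  also have "1 - a * cnj a = of_real (1 - (cmod a)\<^sup>2)"
    by (simp add: complex_norm_square[symmetric])
  also have "s = q * (1 - (cnj a - of_real t) / q * z)"
    using q by (simp add: s_def right_diff_distrib)
  finally show ?thesis by (simp add: q_def power2_eq_square mult_ac)
qed

text \<open>
  By the formula above the mean square reduces to that of one Cauchy kernel \<open>1 / (1 - w z)\<close>, which
  is at most \<open>1 / (1 - |w|\<^sup>2)\<close>; and \<open>1 - |w|\<^sup>2\<close> is known from the invariance of the pseudohyperbolic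
  distance. The factors \<open>|1 - t a|\<close> and \<open>1 - t\<^sup>2\<close> are replaced by smaller ones so that the bound
  becomes an increasing function of \<open>t\<close>.
\<close>

lemma disc_kernel_diff_hardy2:
  fixes t :: real
  assumes a: "cmod a < 1" and t: "0 \<le> t" "t < 1" and r: "0 \<le> r" "r < 1"
  shows "integral {0..2 * pi} (\<lambda>\<theta>. (cmod (disc_kernel_diff a t (of_real r * cis \<theta>)))\<^sup>2)
     \<le> 2 * pi * (sqrt (1 - (cmod a)\<^sup>2) / ((1 - cmod a * t) * sqrt (1 - t)))\<^sup>2"
proof -
  define q w where "q = 1 - of_real t * a" and "w = (cnj a - of_real t) / q"
  define A where "A = 1 - (cmod a)\<^sup>2"
  have A: "0 < A" using a by (simp add: A_def abs_square_less_1)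
  have q: "q \<noteq> 0" unfolding q_def using a t by (intro disc_kernel_nonzero) auto
  have t2: "0 < 1 - t\<^sup>2" using t by (simp add: abs_square_less_1)
  have "(cmod q)\<^sup>2 - (cmod (cnj a - of_real t))\<^sup>2 = (1 - t\<^sup>2) * A"
  proof -
    have "cmod (cnj a - of_real t) = cmod (of_real t - a)"
      by (metis complex_cnj_complex_of_real complex_cnj_diff complex_mod_cnj norm_minus_commute)
    thus ?thesis using moebius_identity[of "of_real t" a] t by (simp add: q_def A_def)
  qed
  hence w: "1 - (cmod w)\<^sup>2 = (1 - t\<^sup>2) * A / (cmod q)\<^sup>2"
    using q by (simp add: w_def norm_divide power_divide field_simps)
  have w1: "0 < 1 - (cmod w)\<^sup>2" unfolding w using t2 A q by simp
  define v where "v = w * of_real r"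
  have vw: "(cmod v)\<^sup>2 \<le> (cmod w)\<^sup>2"
    using r by (intro power_mono) (auto simp: v_def norm_mult mult_left_le)
  have v2: "(cmod v)\<^sup>2 < 1" using vw w1 by linarith
  hence v1: "cmod v < 1" by (simp add: abs_square_less_1)
  define K where "K = (t * A * r)\<^sup>2 / (cmod q)^4"
  have "(cmod (disc_kernel_diff a t (of_real r * cis \<theta>)))\<^sup>2 = K * (1 / (cmod (1 - v * cis \<theta>))\<^sup>2)" for \<theta>
    using disc_kernel_diff_eq[OF a _ t, of "of_real r * cis \<theta>"] r t A
    by (simp add: norm_mult norm_divide norm_power K_def v_def w_def q_def A_def[symmetric] power_mult_distrib power_divide mult_ac
        del: of_real_diff of_real_mult of_real_power)
  hence "integral {0..2 * pi} (\<lambda>\<theta>. (cmod (disc_kernel_diff a t (of_real r * cis \<theta>)))\<^sup>2)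
      = K * (2 * pi / (1 - (cmod v)\<^sup>2))"
    unfolding integral_cauchy_kernel_square[OF v1, symmetric]
    by (simp only: Henstock_Kurzweil_Integration.integral_mult_right)
  also have "\<dots> \<le> A\<^sup>2 / (cmod q)^4 * (2 * pi / (1 - (cmod w)\<^sup>2))"
  proof (intro mult_mono divide_left_mono)
    have "t * A * r \<le> 1 * A * 1" using t r A by (intro mult_mono) auto
    hence "(t * A * r)\<^sup>2 \<le> A\<^sup>2" using t r A by (intro power_mono) auto
    thus "K \<le> A\<^sup>2 / (cmod q)^4" unfolding K_def by (intro divide_right_mono) auto
    show "0 < (1 - (cmod v)\<^sup>2) * (1 - (cmod w)\<^sup>2)" using v2 w1 by (intro mult_pos_pos) auto
    show "0 \<le> 2 * pi / (1 - (cmod v)\<^sup>2)" using v2 by (intro divide_nonneg_nonneg) auto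
  qed (use vw in auto)
  also have "\<dots> = 2 * pi * (A / ((cmod q)\<^sup>2 * (1 - t\<^sup>2)))"
  proof -
    have "A\<^sup>2 / Q ^ 4 * (2 * pi / (T * A / Q\<^sup>2)) = 2 * pi * (A / (Q\<^sup>2 * T))"
      if "T \<noteq> 0" "Q \<noteq> 0" for T Q :: real
      using that A by (simp add: field_simps power2_eq_square power4_eq_xxxx)
    from this[of "1 - t\<^sup>2" "cmod q"] show ?thesis using t2 q by (simp add: w)
  qed
  also have "\<dots> \<le> 2 * pi * (A / ((1 - cmod a * t)\<^sup>2 * (1 - t)))"
  proof (intro mult_left_mono divide_left_mono mult_mono power_mono)
    show "1 - cmod a * t \<le> cmod q"
      using norm_triangle_ineq2[of 1 "of_real t * a"] t by (simp add: q_def norm_mult mult_ac)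
    have at: "cmod a * t < 1" using a t by (metis mult_less_cancel_right1 mult_strict_mono norm_ge_zero mult.right_neutral order_le_less zero_less_one mult_zero_right)
    thus "0 \<le> 1 - cmod a * t" by simp
    show "1 - t \<le> 1 - t\<^sup>2" using t by (simp add: power2_eq_square mult_left_le)
    show "0 < (cmod q)\<^sup>2 * (1 - t\<^sup>2) * ((1 - cmod a * t)\<^sup>2 * (1 - t))"
      using q t2 t at by (intro mult_pos_pos) auto
  qed (use t t2 A in auto)
  also have "A / ((1 - cmod a * t)\<^sup>2 * (1 - t)) = (sqrt A / ((1 - cmod a * t) * sqrt (1 - t)))\<^sup>2"
    using A t by (simp add: power_mult_distrib power_divide)
  finally show ?thesis by (simp add: A_def)
qed

section \<open>Measures with a logarithmic Carleson condition\<close>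

text \<open>
  Taking \<open>C\<close> strictly positive makes the Minkowski bound \<open>3 \<pi> C\<close> positive, so that it can be divided by
  even when \<open>\<mu>\<close> is the null measure.
\<close>

locale log_carleson =
  fixes \<mu> :: "real measure" and C :: real
  assumes borel_mu: "borel_measure_01 \<mu>"
    and C_pos: "0 < C"
    and log_carleson: "carleson_01 (density \<mu> (\<lambda>t. ennreal (ln (2 / (1 - t))))) C"
begin

abbreviation "\<nu> \<equiv> density \<mu> (\<lambda>t. ennreal (ln (2 / (1 - t))))"

sublocale nu: carleson_01 \<nu> C by (rule log_carleson)

lemma sets_mu: "sets \<mu> = sets (restrict_space borel {0..<1})"
  using borel_mu by (simp add: borel_measure_01_def)

lemma space_mu [simp]: "space \<mu> = {0..<1}"
  using sets_eq_imp_space_eq[OF sets_mu] by (simp add: space_restrict_space)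

lemma measurable_muI:
  "g \<in> measurable (restrict_space borel {0..<1}) N \<Longrightarrow> g \<in> measurable \<mu> N"
  using measurable_cong_sets[OF sets_mu refl] by blast

lemma borel_measurable_continuous_on_mu:
  fixes g :: "real \<Rightarrow> 'b::topological_space"
  shows "continuous_on {0..<1} g \<Longrightarrow> g \<in> borel_measurable \<mu>"
  by (intro measurable_muI borel_measurable_continuous_on_restrict)

lemma measurable_of_real_mu [measurable]: "complex_of_real \<in> borel_measurable \<mu>"
  and measurable_log_mu [measurable]: "(\<lambda>t. ln (2 / (1 - t))) \<in> borel_measurable \<mu>"
  by (intro borel_measurable_continuous_on_mu continuous_intros; force)+

text \<open>
  The logarithm that bounds \<open>g\<close> is the density of \<open>\<nu>\<close>, so \<open>|g| d\<mu> \<le> K d\<nu>\<close>. For \<open>g\<close> a Bloch function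
  on the radius this moves all estimates from \<open>\<mu>\<close> to the Carleson measure; for \<open>g = 1\<close> it controls \<open>\<mu>\<close>
  itself.
\<close>

lemma integral_log_bounded:
  fixes g h :: "real \<Rightarrow> complex"
  assumes [measurable]: "g \<in> borel_measurable \<mu>"
    and g: "\<And>t. 0 \<le> t \<Longrightarrow> t < 1 \<Longrightarrow> cmod (g t) \<le> K * ln (2 / (1 - t))"
    and h: "integrable \<nu> h" and K: "0 \<le> K"
  shows "integrable \<mu> (\<lambda>t. g t * h t)"
    and "ennreal (cmod (\<integral>t. g t * h t \<partial>\<mu>)) \<le> ennreal K * (\<integral>\<^sup>+t. ennreal (cmod (h t)) \<partial>\<nu>)"
proof -
  have [measurable]: "h \<in> borel_measurable \<mu>"
    using borel_measurable_integrable[OF h] by simp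
  have "(\<integral>\<^sup>+t. ennreal (cmod (g t * h t)) \<partial>\<mu>)
     \<le> (\<integral>\<^sup>+t. ennreal K * (ennreal (ln (2 / (1 - t))) * ennreal (cmod (h t))) \<partial>\<mu>)"
  proof (rule nn_integral_mono)
    fix t assume "t \<in> space \<mu>"
    hence t: "0 \<le> t" "t < 1" by auto
    have "0 \<le> ln (2 / (1 - t))" using t by simp
    moreover have "cmod (g t * h t) \<le> K * ln (2 / (1 - t)) * cmod (h t)"
      unfolding norm_mult by (intro mult_right_mono g t) auto
    ultimately show "ennreal (cmod (g t * h t)) \<le> ennreal K * (ennreal (ln (2 / (1 - t))) * ennreal (cmod (h t)))"
      using K by (simp add: mult.assoc flip: ennreal_mult)
  qed
  also have "\<dots> = ennreal K * (\<integral>\<^sup>+t. ennreal (cmod (h t)) \<partial>\<nu>)"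
    by (simp add: nn_integral_cmult nn_integral_density)
  finally have le: "(\<integral>\<^sup>+t. ennreal (cmod (g t * h t)) \<partial>\<mu>) \<le> ennreal K * (\<integral>\<^sup>+t. ennreal (cmod (h t)) \<partial>\<nu>)" .
  have "(\<integral>\<^sup>+t. ennreal (cmod (h t)) \<partial>\<nu>) < \<infinity>" using h by (simp add: integrable_iff_bounded)
  hence "ennreal K * (\<integral>\<^sup>+t. ennreal (cmod (h t)) \<partial>\<nu>) < \<infinity>" by (simp add: ennreal_mult_less_top)
  hence fin: "(\<integral>\<^sup>+t. ennreal (cmod (g t * h t)) \<partial>\<mu>) < \<infinity>" using le by (rule le_less_trans[rotated])
  show int: "integrable \<mu> (\<lambda>t. g t * h t)"
    by (rule integrableI_bounded[OF _ fin]) measurable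
  have "ennreal (cmod (\<integral>t. g t * h t \<partial>\<mu>)) \<le> ennreal (\<integral>t. cmod (g t * h t) \<partial>\<mu>)"
    by (intro ennreal_leI integral_norm_bound)
  also have "\<dots> = (\<integral>\<^sup>+t. ennreal (cmod (g t * h t)) \<partial>\<mu>)"
    using int by (intro nn_integral_eq_integral[symmetric]) auto
  also note le
  finally show "ennreal (cmod (\<integral>t. g t * h t \<partial>\<mu>)) \<le> ennreal K * (\<integral>\<^sup>+t. ennreal (cmod (h t)) \<partial>\<nu>)" .
qed

lemma integrable_nu_bounded:
  fixes h :: "real \<Rightarrow> complex"
  assumes "continuous_on {0..<1} h" and "\<And>t. 0 \<le> t \<Longrightarrow> t < 1 \<Longrightarrow> cmod (h t) \<le> B"
  shows "integrable \<nu> h"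
proof -
  interpret finite_measure \<nu> by (rule nu.finite_nu)
  show ?thesis
    using assms by (intro integrable_const_bound[where B = B] AE_I2)
      (auto intro: borel_measurable_continuous_on_mu)
qed

text \<open>
  The powers \<open>t ^ n\<close> are increasing, so the Carleson condition compares their integrals with
  \<open>1 / (n + 1)\<close>; and \<open>\<mu> \<le> 2 \<nu>\<close> because \<open>ln 2 \<ge> 1/2\<close>.
\<close>

lemma integrable_power_mu: "integrable \<mu> (\<lambda>t. t ^ n)"
  and moment_le: "moment \<mu> n \<le> 2 * C / (real n + 1)"
  and moment_nonneg: "0 \<le> moment \<mu> n"
proof -
  have half: "1 \<le> 2 * ln (2 / (1 - t))" if "0 \<le> t" "t < 1" for t :: real
  proof -
    note half_le_ln_2
    also have "ln 2 \<le> ln (2 / (1 - t))" using that by (subst ln_le_cancel_iff) (auto simp: field_simps)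
    finally show ?thesis by simp
  qed
  have int_nu: "integrable \<nu> (\<lambda>t. complex_of_real (t ^ n))"
    by (rule integrable_nu_bounded[where B = 1])
      (auto intro!: continuous_intros power_le_one simp: norm_power)
  note * = integral_log_bounded[of "\<lambda>_. 1" 2, OF _ _ int_nu, simplified, OF half]
  have "integrable \<mu> (\<lambda>t. complex_of_real (t ^ n))" using *(1) by simp
  thus int: "integrable \<mu> (\<lambda>t. t ^ n)" by (simp only: complex_of_real_integrable_eq)
  show nonneg: "0 \<le> moment \<mu> n"
    unfolding moment_def by (intro integral_nonneg_AE AE_I2) auto
  have "ennreal (moment \<mu> n) = ennreal (cmod (\<integral>t. complex_of_real (t ^ n) \<partial>\<mu>))"
    using nonneg by (simp only: integral_complex_of_real moment_def[symmetric] norm_of_real abs_of_nonneg)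
  also have "\<dots> \<le> 2 * (\<integral>\<^sup>+t. ennreal (cmod (complex_of_real (t ^ n))) \<partial>\<nu>)" using *(2) by simp
  also have "(\<integral>\<^sup>+t. ennreal (cmod (complex_of_real (t ^ n))) \<partial>\<nu>) = (\<integral>\<^sup>+t. ennreal (t ^ n) \<partial>\<nu>)"
    by (intro nn_integral_cong) (auto simp: norm_power)
  also have "\<dots> \<le> ennreal C * (\<integral>\<^sup>+t. ennreal (t ^ n) * indicator {0..<1} t \<partial>lborel)"
    by (rule nu.integral_increasing_le) (auto intro!: mono_onI power_mono)
  also have "(\<integral>\<^sup>+t. ennreal (t ^ n) * indicator {0..<1} t \<partial>lborel)
      \<le> (\<integral>\<^sup>+t. ennreal (t ^ n) * indicator {0..1} t \<partial>lborel)"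
    by (intro nn_integral_mono) (auto split: split_indicator)
  also have "\<dots> = ennreal (1 ^ Suc n / real (Suc n) - 0 ^ Suc n / real (Suc n))"
  proof (rule nn_integral_FTC_Icc)
    show "((\<lambda>t. t ^ Suc n / real (Suc n)) has_real_derivative t ^ n) (at t)" for t
      using DERIV_cdivide[OF DERIV_pow[of "Suc n" t], of "real (Suc n)"] by (simp del: of_nat_Suc)
  qed auto
  also have "2 * (ennreal C * \<dots>) = ennreal (2 * C / (real n + 1))"
    using C_pos by (simp add: add.commute flip: ennreal_mult ennreal_numeral)
  finally have "ennreal (moment \<mu> n) \<le> ennreal (2 * C / (real n + 1))" by (simp add: mult_left_mono)
  thus "moment \<mu> n \<le> 2 * C / (real n + 1)"
    using C_pos by (subst (asm) ennreal_le_iff) auto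
qed

lemma integrable_cauchy_kernel:
  assumes z: "cmod z < 1"
  shows "integrable \<nu> (\<lambda>t. 1 / (1 - of_real t * z))"
proof (rule integrable_nu_bounded)
  show "continuous_on {0..<1} (\<lambda>t. 1 / (1 - complex_of_real t * z))"
    using disc_kernel_nonzero[OF z] by (intro continuous_intros) auto
  fix t :: real assume t: "0 \<le> t" "t < 1"
  have "1 - cmod z \<le> 1 - t * cmod z" using t by (simp add: mult_left_le_one_le)
  also have "\<dots> \<le> cmod (1 - of_real t * z)"
    using norm_triangle_ineq2[of 1 "of_real t * z"] t by (simp add: norm_mult)
  finally show "cmod (1 / (1 - of_real t * z)) \<le> 1 / (1 - cmod z)"
    using z by (simp add: norm_divide frac_le)
qed

lemma integrable_disc_kernel_diff:
  assumes "cmod a < 1" "cmod z < 1"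
  shows "integrable \<nu> (\<lambda>t. disc_kernel_diff a t z)"
  unfolding disc_kernel_diff_def
  using assms by (intro Bochner_Integration.integrable_diff integrable_cauchy_kernel disc_aut_in_disc)

abbreviation "circle \<equiv> restrict_space lborel {0..2 * pi}"

lemma finite_measure_circle: "finite_measure circle"
  by (rule finite_measureI) (simp add: space_restrict_space emeasure_restrict_space)

lemma disc_kernel_diff_measurable:
  "(\<lambda>(\<theta>, t). cmod (disc_kernel_diff a t (of_real r * cis \<theta>))) \<in> borel_measurable (circle \<Otimes>\<^sub>M \<nu>)"
proof -
  have cis_meas [measurable]: "cis \<in> borel_measurable circle"
    by (intro measurable_restrict_space1) 
      (simp add: borel_measurable_continuous_onI continuous_intros)
  have of_real_meas [measurable]: "complex_of_real \<in> borel_measurable \<nu>"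
    using measurable_of_real_mu by simp
  show ?thesis unfolding disc_kernel_diff_def disc_aut_def by measurable
qed

text \<open>
  The Carleson condition is used here, to integrate the increasing majorant \<open>w\<close> of the Hardy norms
  with a bound that is uniform in \<open>a\<close>.
\<close>

lemma disc_kernel_diff_minkowski:
  assumes a: "cmod a < 1" and r: "0 \<le> r" "r < 1"
  shows "(\<integral>\<^sup>+\<theta>. (\<integral>\<^sup>+t. ennreal (cmod (disc_kernel_diff a t (of_real r * cis \<theta>))) \<partial>\<nu>)\<^sup>2
            \<partial>circle)
       \<le> ennreal (2 * pi * (3 * pi * C)\<^sup>2)"
proof -
  interpret finite_measure \<nu> by (rule nu.finite_nu)
  interpret R: finite_measure circle by (rule finite_measure_circle)
  define w where "w = (\<lambda>t. sqrt (1 - (cmod a)\<^sup>2) / ((1 - cmod a * t) * sqrt (1 - t)))"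
  have at: "0 < 1 - cmod a * t" if "0 \<le> t" "t < 1" for t
    using that a mult_left_le[of t "cmod a"] by simp
  have w_pos: "0 < w t" if "0 \<le> t" "t < 1" for t
    using at[OF that] that a by (simp add: w_def abs_square_less_1)
  have w_mono: "mono_on {0..<1} w"
  proof (rule mono_onI)
    fix s t :: real assume st: "s \<in> {0..<1}" "t \<in> {0..<1}" "s \<le> t"
    show "w s \<le> w t" unfolding w_def
      using st at[of s] at[of t] a
      by (intro divide_left_mono mult_mono mult_pos_pos) (auto intro: mult_left_mono simp: abs_square_le_1)
  qed
  have w_meas: "w \<in> borel_measurable \<nu>"
    using w_mono by (intro nu.measurable_nuI borel_measurable_mono_on_fnc)
  have w_int: "(\<integral>\<^sup>+t. ennreal (w t) \<partial>\<nu>) \<le> ennreal (3 * pi * C)"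
  proof -
    have "(\<integral>\<^sup>+t. ennreal (w t) \<partial>\<nu>) \<le> ennreal C * (\<integral>\<^sup>+t. ennreal (w t) * indicator {0..<1} t \<partial>lborel)"
      by (rule nu.integral_increasing_le[OF w_mono])
    also have "\<dots> \<le> ennreal C * ennreal (3 * pi)"
      unfolding w_def using a by (intro mult_left_mono nn_integral_disc_kernel_le) auto
    also have "\<dots> = ennreal (3 * pi * C)" using C_pos by (simp add: mult_ac flip: ennreal_mult)
    finally show ?thesis .
  qed
  have "(\<integral>\<^sup>+\<theta>. (\<integral>\<^sup>+t. ennreal \<bar>cmod (disc_kernel_diff a t (of_real r * cis \<theta>))\<bar> \<partial>\<nu>)\<^sup>2 \<partial>circle)
       \<le> ennreal (2 * pi * (3 * pi * C)\<^sup>2)"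
  proof (rule minkowski_square[OF _ _ disc_kernel_diff_measurable w_meas _ w_int])
    show "0 < w t" if "t \<in> space \<nu>" for t using that w_pos by simp
  next
    fix t assume "t \<in> space \<nu>"
    hence t: "0 \<le> t" "t < 1" by simp_all
    define k where "k = (\<lambda>\<theta>. (cmod (disc_kernel_diff a t (of_real r * cis \<theta>)))\<^sup>2)"
    have cont: "continuous_on {0..2*pi} k"
      unfolding k_def disc_kernel_diff_def disc_aut_def
    proof (intro continuous_intros ballI)
      fix \<theta> :: real
      have z: "cmod (of_real r * cis \<theta>) < 1" using r by (simp add: norm_mult)
      show "1 - cnj a * (complex_of_real r * cis \<theta>) \<noteq> 0"
        by (rule disc_kernel_nonzero[OF z]) (use a in auto)
      show "1 - complex_of_real t * ((a - complex_of_real r * cis \<theta>) / (1 - cnj a * (complex_of_real r * cis \<theta>))) \<noteq> 0"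
        using disc_kernel_nonzero[OF disc_aut_in_disc[OF a z], of "of_real t"] t by (simp add: disc_aut_def)
    qed
    have "(\<integral>\<^sup>+\<theta>. ennreal (k \<theta>) \<partial>circle) = ennreal (integral {0..2*pi} k)"
      by (rule nn_integral_continuous_Icc[OF cont]) (simp add: k_def)
    also have "\<dots> \<le> ennreal (2 * pi * (w t)\<^sup>2)"
      unfolding k_def w_def by (intro ennreal_leI disc_kernel_diff_hardy2 a t r)
    finally show "(\<integral>\<^sup>+\<theta>. ennreal ((cmod (disc_kernel_diff a t (of_real r * cis \<theta>)))\<^sup>2) \<partial>circle) \<le> ennreal (2 * pi * (w t)\<^sup>2)"
      by (simp add: k_def)
  qed (use C_pos R.sigma_finite_measure_axioms sigma_finite_measure_axioms in auto)
  thus ?thesis by simp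
qed

end

section \<open>The Hankel operator on a Bloch function\<close>

locale hankel_bloch = log_carleson \<mu> C + bloch_function f \<beta>
  for \<mu> C f \<beta>
begin

lemma integral_f_bounded:
  assumes h: "integrable \<nu> h"
  shows "integrable \<mu> (\<lambda>t. f (of_real t) * h t)"
    and "ennreal (cmod (\<integral>t. f (of_real t) * h t \<partial>\<mu>)) \<le> ennreal (2 * \<beta>) * (\<integral>\<^sup>+t. ennreal (cmod (h t)) \<partial>\<nu>)"
  using integral_log_bounded[of "\<lambda>t. f (of_real t)" "2 * \<beta>" h]
    borel_measurable_continuous_on_mu[OF continuous_f] growth beta_nonneg h
  by auto

lemma integrable_f: "integrable \<mu> (\<lambda>t. f (of_real t))"
  using integral_f_bounded(1)[OF integrable_nu_bounded[of "\<lambda>_. 1" 1]] by simp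

lemma hankel_coeff_abs_summable:
  "summable (\<lambda>k. cmod (of_real (moment \<mu> (n + k)) * taylor_coeff f k))"
proof (rule summable_comparison_test'[where N = 0])
  show "summable (\<lambda>k. 2 * C * (cmod (taylor_coeff f k) / (real k + 1)))"
    by (intro summable_mult coeff_summable)
  fix k
  have "cmod (of_real (moment \<mu> (n + k)) * taylor_coeff f k) = moment \<mu> (n + k) * cmod (taylor_coeff f k)"
    by (simp add: norm_mult moment_nonneg)
  also have "\<dots> \<le> 2 * C / (real (n + k) + 1) * cmod (taylor_coeff f k)"
    by (intro mult_right_mono moment_le) auto
  also have "\<dots> \<le> 2 * C / (real k + 1) * cmod (taylor_coeff f k)"
    using C_pos by (intro mult_right_mono divide_left_mono) auto
  finally show "norm (cmod (of_real (moment \<mu> (n + k)) * taylor_coeff f k)) \<le> 2 * C * (cmod (taylor_coeff f k) / (real k + 1))"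
    by simp
qed

text \<open>
  Fubini's theorem for the Taylor series of \<open>f\<close>. The exchange is justified by the absolute convergence of the
  coefficient series.
\<close>

lemma hankel_coeff_eq: "hankel_coeff \<mu> f n = (\<integral>t. of_real t ^ n * f (of_real t) \<partial>\<mu>)"
proof -
  define g where "g = (\<lambda>k t. complex_of_real (t ^ (n + k)) * taylor_coeff f k)"
  have norm_g: "cmod (g k t) = t ^ (n + k) * cmod (taylor_coeff f k)" if "t \<in> space \<mu>" for k t
    using that by (simp add: g_def norm_mult norm_power)
  have int_g: "integrable \<mu> (g k)" for k
    unfolding g_def by (intro integrable_mult_left integrable_of_real integrable_power_mu)
  have val: "(\<integral>t. g k t \<partial>\<mu>) = of_real (moment \<mu> (n + k)) * taylor_coeff f k" for k
    unfolding g_def moment_def by (simp only: integral_mult_left_zero integral_complex_of_real)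
  have val_norm: "(\<integral>t. cmod (g k t) \<partial>\<mu>) = cmod (of_real (moment \<mu> (n + k)) * taylor_coeff f k)" for k
  proof -
    have "(\<integral>t. cmod (g k t) \<partial>\<mu>) = (\<integral>t. t ^ (n + k) * cmod (taylor_coeff f k) \<partial>\<mu>)"
      by (intro Bochner_Integration.integral_cong norm_g refl)
    also have "\<dots> = moment \<mu> (n + k) * cmod (taylor_coeff f k)"
      unfolding moment_def by (simp only: integral_mult_left_zero)
    finally show ?thesis by (simp add: norm_mult moment_nonneg)
  qed
  have "(\<integral>t. (\<Sum>k. g k t) \<partial>\<mu>) = (\<Sum>k. \<integral>t. g k t \<partial>\<mu>)"
  proof (rule integral_suminf)
    show "AE t in \<mu>. summable (\<lambda>k. norm (g k t))"
    proof (rule AE_I2)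
      fix t assume t: "t \<in> space \<mu>"
      hence "summable (\<lambda>k. t ^ n * (cmod (taylor_coeff f k) * t ^ k))"
        by (intro summable_mult taylor_abs_summable[OF f]) auto
      thus "summable (\<lambda>k. norm (g k t))" using t by (simp add: norm_g power_add mult_ac)
    qed
    show "summable (\<lambda>k. \<integral>t. norm (g k t) \<partial>\<mu>)"
      unfolding val_norm by (rule hankel_coeff_abs_summable)
  qed (rule int_g)
  also have "\<dots> = hankel_coeff \<mu> f n" by (simp add: hankel_coeff_def val)
  also have "(\<integral>t. (\<Sum>k. g k t) \<partial>\<mu>) = (\<integral>t. of_real t ^ n * f (of_real t) \<partial>\<mu>)"
  proof (intro Bochner_Integration.integral_cong refl)
    fix t assume "t \<in> space \<mu>"
    hence "(\<lambda>k. of_real t ^ n * (taylor_coeff f k * of_real t ^ k)) sums (of_real t ^ n * f (of_real t))"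
      by (intro sums_mult taylor_sums[OF f]) auto
    thus "(\<Sum>k. g k t) = of_real t ^ n * f (of_real t)"
      by (simp add: g_def power_add mult_ac sums_iff)
  qed
  finally show ?thesis ..
qed

lemma hankel_op_sums:
  assumes z: "cmod z < 1"
  shows "(\<lambda>n. hankel_coeff \<mu> f n * z ^ n) sums (\<integral>t. f (of_real t) * (1 / (1 - of_real t * z)) \<partial>\<mu>)"
proof -
  define g where "g = (\<lambda>n t. of_real t ^ n * f (of_real t) * z ^ n)"
  have int_n: "integrable \<mu> (\<lambda>t. of_real t ^ n * f (of_real t))" for n
  proof -
    have "integrable \<nu> (\<lambda>t. complex_of_real t ^ n)"
      by (rule integrable_nu_bounded[where B = 1])
        (auto intro!: continuous_intros power_le_one simp: norm_power)
    from integral_f_bounded(1)[OF this] show ?thesis by (simp only: mult.commute)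
  qed
  have int_g: "integrable \<mu> (g n)" for n
    unfolding g_def by (intro integrable_mult_left int_n)
  have norm_g: "cmod (g n t) \<le> cmod (f (of_real t)) * cmod z ^ n" if "t \<in> space \<mu>" for n t
  proof -
    have "t ^ n \<le> 1" "0 \<le> t" using that by (auto intro: power_le_one)
    hence "t ^ n * (cmod (f (of_real t)) * cmod z ^ n) \<le> 1 * (cmod (f (of_real t)) * cmod z ^ n)"
      by (intro mult_right_mono) auto
    thus ?thesis using \<open>0 \<le> t\<close> by (simp add: g_def norm_mult norm_power mult_ac)
  qed
  have geo: "summable (\<lambda>n. a * cmod z ^ n)" for a :: real
    using z by (intro summable_mult summable_geometric) auto
  have "(\<lambda>n. \<integral>t. g n t \<partial>\<mu>) sums (\<integral>t. (\<Sum>n. g n t) \<partial>\<mu>)"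
  proof (rule sums_integral)
    show "AE t in \<mu>. summable (\<lambda>n. norm (g n t))"
    proof (rule AE_I2)
      fix t assume t: "t \<in> space \<mu>"
      show "summable (\<lambda>n. norm (g n t))"
        using norm_g[OF t] by (intro summable_comparison_test'[where N = 0, OF geo]) auto
    qed
    show "summable (\<lambda>n. \<integral>t. norm (g n t) \<partial>\<mu>)"
    proof (rule summable_comparison_test'[where N = 0, OF geo])
      fix n
      have "(\<integral>t. norm (g n t) \<partial>\<mu>) \<le> (\<integral>t. cmod (f (of_real t)) * cmod z ^ n \<partial>\<mu>)"
        using int_g integrable_f by (intro integral_mono norm_g) auto
      also have "\<dots> = (\<integral>t. cmod (f (of_real t)) \<partial>\<mu>) * cmod z ^ n"
        by simp
      finally show "norm (\<integral>t. norm (g n t) \<partial>\<mu>) \<le> (\<integral>t. cmod (f (of_real t)) \<partial>\<mu>) * cmod z ^ n"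
        by simp
    qed
  qed (rule int_g)
  moreover have "(\<integral>t. g n t \<partial>\<mu>) = hankel_coeff \<mu> f n * z ^ n" for n
    unfolding g_def hankel_coeff_eq by (simp only: integral_mult_left_zero)
  moreover have "(\<integral>t. (\<Sum>n. g n t) \<partial>\<mu>) = (\<integral>t. f (of_real t) * (1 / (1 - of_real t * z)) \<partial>\<mu>)"
  proof (intro Bochner_Integration.integral_cong refl)
    fix t assume t: "t \<in> space \<mu>"
    have "cmod (of_real t * z) < 1"
      using t z mult_left_le_one_le[of "cmod z" t] by (simp add: norm_mult)
    hence "(\<lambda>n. f (of_real t) * (of_real t * z) ^ n) sums (f (of_real t) * (1 / (1 - of_real t * z)))"
      by (intro sums_mult geometric_sums)
    thus "(\<Sum>n. g n t) = f (of_real t) * (1 / (1 - of_real t * z))"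
      by (simp add: g_def power_mult_distrib mult_ac sums_iff)
  qed
  ultimately show ?thesis by simp
qed

lemma hankel_op_eq:
  "cmod z < 1 \<Longrightarrow> hankel_op \<mu> f z = (\<integral>t. f (of_real t) * (1 / (1 - of_real t * z)) \<partial>\<mu>)"
  unfolding hankel_op_def using hankel_op_sums by (simp add: sums_iff)

lemma hankel_op_holomorphic: "hankel_op \<mu> f holomorphic_on unit_disc"
proof (rule power_series_holomorphic)
  fix z :: complex assume "z \<in> unit_disc"
  thus "(\<lambda>n. hankel_coeff \<mu> f n * (z - 0) ^ n) sums hankel_op \<mu> f z"
    using hankel_op_sums[of z] by (simp add: hankel_op_eq)
qed

lemma hankel_well_defined: "hankel_well_defined \<mu> f"
  unfolding hankel_well_defined_def
  using integrable_power_mu summable_norm_cancel[OF hankel_coeff_abs_summable] hankel_op_holomorphic hankel_op_sums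
  by (auto simp: sums_iff)

lemma hankel_op_disc_diff:
  assumes a: "cmod a < 1" and z: "cmod z < 1"
  shows "hankel_op \<mu> f (disc_aut a z) - hankel_op \<mu> f a = (\<integral>t. f (of_real t) * disc_kernel_diff a t z \<partial>\<mu>)"
proof -
  note int = integral_f_bounded(1)[OF integrable_cauchy_kernel]
  show ?thesis
    unfolding hankel_op_eq[OF disc_aut_in_disc[OF a z]] hankel_op_eq[OF a] disc_kernel_diff_def right_diff_distrib
    by (rule Bochner_Integration.integral_diff[symmetric]) (intro int disc_aut_in_disc a z)+
qed

lemma hankel_op_0_le: "cmod (hankel_op \<mu> f 0) \<le> 2 * C * \<beta>"
proof -
  have "ennreal (cmod (hankel_op \<mu> f 0)) \<le> ennreal (2 * \<beta>) * (\<integral>\<^sup>+t. ennreal (cmod 1) \<partial>\<nu>)"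
    using integral_f_bounded(2)[OF integrable_nu_bounded[of "\<lambda>_. 1" 1]]
    hankel_op_eq[of 0] by simp
  also have "\<dots> \<le> ennreal (2 * \<beta>) * ennreal C"
    using nu.total_mass_le by (intro mult_left_mono) (auto simp del: emeasure_density)
  also have "\<dots> = ennreal (2 * C * \<beta>)"
    using C_pos beta_nonneg by (simp add: mult_ac flip: ennreal_mult)
  finally show ?thesis using C_pos beta_nonneg by (subst (asm) ennreal_le_iff) auto
qed

lemma hardy2_norm_hankel_op_le:
  assumes a: "cmod a < 1"
  shows "hardy2_norm (\<lambda>z. hankel_op \<mu> f (disc_aut a z) - hankel_op \<mu> f a) \<le> ennreal (6 * pi * C * \<beta>)"
  unfolding hardy2_norm_def
proof (rule SUP_least, rule ennreal_leI)
  fix r :: real assume "r \<in> {0..<1}"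
  hence r: "0 \<le> r" "r < 1" by auto
  interpret finite_measure \<nu> by (rule nu.finite_nu)
  define g where "g = (\<lambda>\<theta>. hankel_op \<mu> f (disc_aut a (of_real r * cis \<theta>)) - hankel_op \<mu> f a)"
  define I where "I = (\<lambda>\<theta>. \<integral>\<^sup>+t. ennreal (cmod (disc_kernel_diff a t (of_real r * cis \<theta>))) \<partial>\<nu>)"
  have z: "cmod (of_real r * cis \<theta>) < 1" for \<theta> using r by (simp add: norm_mult)
  have nz: "1 - cnj a * (complex_of_real r * cis \<theta>) \<noteq> 0" for \<theta>
    by (rule disc_kernel_nonzero[OF z]) (use a in auto)
  note \<beta> = beta_nonneg
  have "continuous_on {0..2*pi} (\<lambda>\<theta>. disc_aut a (of_real r * cis \<theta>))"
    unfolding disc_aut_def using nz by (intro continuous_intros) auto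
  hence cont: "continuous_on {0..2*pi} g" unfolding g_def
    using disc_aut_in_disc[OF a z]
    by (intro continuous_intros
        continuous_on_compose2[OF holomorphic_on_imp_continuous_on[OF hankel_op_holomorphic]]) auto
  have meas [measurable]: "I \<in> borel_measurable circle"
    unfolding I_def using disc_kernel_diff_measurable[of a r]
    by (intro borel_measurable_nn_integral) (simp add: case_prod_unfold)
  have g_le: "ennreal (cmod (g \<theta>)) \<le> ennreal (2 * \<beta>) * I \<theta>" for \<theta>
    unfolding g_def I_def hankel_op_disc_diff[OF a z]
    by (rule integral_f_bounded(2)[OF integrable_disc_kernel_diff[OF a z]])
  have "ennreal (integral {0..2*pi} (\<lambda>\<theta>. (cmod (g \<theta>))\<^sup>2)) = (\<integral>\<^sup>+\<theta>. ennreal ((cmod (g \<theta>))\<^sup>2) \<partial>circle)"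
    by (rule nn_integral_continuous_Icc[symmetric]) (auto intro!: continuous_intros cont)
  also have "\<dots> \<le> (\<integral>\<^sup>+\<theta>. (ennreal (2 * \<beta>))\<^sup>2 * (I \<theta>)\<^sup>2 \<partial>circle)"
  proof (rule nn_integral_mono)
    fix \<theta>
    have "ennreal ((cmod (g \<theta>))\<^sup>2) = (ennreal (cmod (g \<theta>)))\<^sup>2" by (simp add: ennreal_power)
    also have "\<dots> \<le> (ennreal (2 * \<beta>) * I \<theta>)\<^sup>2" by (intro power_mono g_le) auto
    finally show "ennreal ((cmod (g \<theta>))\<^sup>2) \<le> (ennreal (2 * \<beta>))\<^sup>2 * (I \<theta>)\<^sup>2"
      by (simp add: power_mult_distrib)
  qed
  also have "\<dots> = (ennreal (2 * \<beta>))\<^sup>2 * (\<integral>\<^sup>+\<theta>. (I \<theta>)\<^sup>2 \<partial>circle)"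
    by (rule nn_integral_cmult) measurable
  also have "\<dots> \<le> (ennreal (2 * \<beta>))\<^sup>2 * ennreal (2 * pi * (3 * pi * C)\<^sup>2)"
    unfolding I_def by (intro mult_left_mono disc_kernel_diff_minkowski a r) auto
  also have "\<dots> = ennreal ((2 * \<beta>)\<^sup>2 * (2 * pi * (3 * pi * C)\<^sup>2))"
    using \<beta> by (simp add: ennreal_power flip: ennreal_mult)
  finally have "integral {0..2*pi} (\<lambda>\<theta>. (cmod (g \<theta>))\<^sup>2) \<le> (2 * \<beta>)\<^sup>2 * (2 * pi * (3 * pi * C)\<^sup>2)"
    by (subst (asm) ennreal_le_iff) auto
  hence "1 / (2 * pi) * integral {0..2*pi} (\<lambda>\<theta>. (cmod (g \<theta>))\<^sup>2)
      \<le> 1 / (2 * pi) * ((2 * \<beta>)\<^sup>2 * (2 * pi * (3 * pi * C)\<^sup>2))"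
    by (intro mult_left_mono) auto
  also have "\<dots> = (6 * pi * C * \<beta>)\<^sup>2" by (simp add: power2_eq_square)
  finally show "sqrt (1 / (2 * pi) * integral {0..2*pi}
      (\<lambda>\<theta>. (cmod (hankel_op \<mu> f (disc_aut a (of_real r * cis \<theta>)) - hankel_op \<mu> f a))\<^sup>2)) \<le> 6 * pi * C * \<beta>"
    using \<beta> C_pos unfolding g_def by (intro real_le_lsqrt) auto
qed

lemma bmoa_norm_hankel_op_le: "bmoa_norm (hankel_op \<mu> f) \<le> ennreal ((2 * C + 6 * pi * C) * \<beta>)"
proof -
  have "bmoa_norm (hankel_op \<mu> f) \<le> ennreal (2 * C * \<beta>) + ennreal (6 * pi * C * \<beta>)"
    unfolding bmoa_norm_def
    by (intro add_mono ennreal_leI hankel_op_0_le SUP_least hardy2_norm_hankel_op_le) simp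
  also have "\<dots> = ennreal ((2 * C + 6 * pi * C) * \<beta>)"
    using C_pos beta_nonneg by (simp add: distrib_right flip: ennreal_plus)
  finally show ?thesis .
qed

end

lemma (in log_carleson) hankel_bounded: "hankel_bounded_bloch_bmoa \<mu>"
proof -
  define K where "K = 2 * C + 6 * pi * C"
  have K: "0 \<le> K" using C_pos by (simp add: K_def)
  have *: "hankel_well_defined \<mu> f \<and> hankel_op \<mu> f \<in> bmoa \<and> bmoa_norm (hankel_op \<mu> f) \<le> ennreal K * bloch_norm f"
    if "f \<in> bloch" for f
  proof -
    define \<beta> where "\<beta> = enn2real (bloch_norm f)"
    have hol: "f holomorphic_on unit_disc" and fin: "bloch_norm f < \<infinity>"
      using that by (auto simp: bloch_def)
    have norm_eq: "bloch_norm f = ennreal \<beta>" using fin by (simp add: \<beta>_def)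
    have \<beta>: "0 \<le> \<beta>" by (simp add: \<beta>_def)
    have "ennreal (cmod (f 0)) \<le> bloch_norm f"
      unfolding bloch_norm_def by simp
    hence f0: "cmod (f 0) \<le> \<beta>" using \<beta> by (simp add: norm_eq)
    have f': "(1 - (cmod z)\<^sup>2) * cmod (deriv f z) \<le> \<beta>" if "z \<in> unit_disc" for z
    proof -
      have "ennreal ((1 - (cmod z)\<^sup>2) * cmod (deriv f z))
          \<le> (SUP z\<in>unit_disc. ennreal ((1 - (cmod z)\<^sup>2) * cmod (deriv f z)))"
        using that by (rule SUP_upper)
      also have "\<dots> \<le> bloch_norm f" unfolding bloch_norm_def by simp
      finally show ?thesis using \<beta> by (simp add: norm_eq)
    qed
    interpret hankel_bloch \<mu> C f \<beta>
      using hol f0 f' by unfold_locales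
    have le: "bmoa_norm (hankel_op \<mu> f) \<le> ennreal K * bloch_norm f"
      using bmoa_norm_hankel_op_le K \<beta> by (simp add: K_def norm_eq ennreal_mult)
    also have "\<dots> < \<infinity>" by (simp add: norm_eq ennreal_mult_less_top)
    finally have "hankel_op \<mu> f \<in> bmoa"
      using hankel_op_holomorphic by (simp add: bmoa_def)
    thus ?thesis using hankel_well_defined le by blast
  qed
  thus ?thesis unfolding hankel_bounded_bloch_bmoa_def using K by blast
qed

theorem theorem2p4:
  fixes \<mu> :: "real measure"
  assumes "borel_measure_01 \<mu>"
    and "carleson_measure (density \<mu> (\<lambda>t. ennreal (ln (2 / (1 - t)))))"
  shows "hankel_bounded_bloch_bmoa \<mu>"
proof -
  obtain C where "0 < C" "carleson_01 (density \<mu> (\<lambda>t. ennreal (ln (2 / (1 - t))))) C"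
    using assms(2) by (force simp: carleson_measure_def borel_measure_01_def carleson_01_def)
  hence "log_carleson \<mu> C" using assms(1) by (simp add: log_carleson_def)
  then interpret log_carleson \<mu> C .
  show ?thesis by (rule hankel_bounded)
qed

end
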